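(* Let $\alpha\in(0,1]$ be rational, let $K$ be a positive integer, and let $\beta=K\alpha$ with $\beta\le1$. Let $a_1,a_2,b_1,b_2\in\mathbb{R}$, and consider the mixed index 2 problem $$D_t^{\alpha}y_1=a_1y_1+a_2y_2,\qquad D_t^{\beta}y_2=b_1y_1+b_2y_2,$$ with initial value $y(0)=(y_1(0),y_2(0))^\top\in\mathbb{R}^2$. Put $D_A=a_1b_2-a_2b_1$ and factorise $$w^{K+1}-a_1w^{K}-b_2w+D_A=\prod_{j=1}^{K+1}(w-\lambda_j).$$ Then the solution is given by $$y(t)=\sum_{j=1}^{K+1}A_j\,E_{\alpha}(\lambda_jt^{\alpha}),$$ where the vectors $A_j=(A_j^{(1)},A_j^{(2)})^\top$ and the "eigenvalues" $\lambda_j$ satisfy $$\sum_{j=1}^{K+1}\frac{A_j}{w-\lambda_j}=\frac{1}{w^{K+1}-a_1w^{K}-b_2w+D_A}\left(w^{K}y(0)+\begin{pmatrix} a_2 \\ -a_1 \end{pmatrix}w^{K-1}y_2(0)+\begin{pmatrix} -b_2 \\ b_1 \end{pmatrix}y_1(0)\right).$$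
   Context: $D_t^\gamma$ denotes the Caputo derivative of order $\gamma\in(0,1]$ with starting point $0$: $D_t^{\gamma}u(t)=\frac{1}{\Gamma(1-\gamma)}\int_0^t\frac{u'(s)}{(t-s)^{\gamma}}\,ds$ for $0<\gamma<1$ and $D_t^1u=u'$. The Mittag-Leffler function is $E_{\alpha}(x)=\sum_{k=0}^\infty\frac{x^k}{\Gamma(1+\alpha k)}$. The variable $w$ stands for $s^\alpha$, with $s$ the Laplace variable.
   Formalization: That vectors A_j satisfying the partial-fraction identity exist is asserted only when the λ_j are distinct; for repeated λ_j they may fail to exist, and then the solution formula is asserted for every family A_j that does satisfy the identity. *)

theory Defs
  imports "HOL-Analysis.Analysis"
begin

definition mittag_leffler :: "real \<Rightarrow> complex \<Rightarrow> complex" where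
  "mittag_leffler \<alpha> x = (\<Sum>k. x ^ k / of_real (Gamma (1 + \<alpha> * real k)))"

(* The values of the integrand at the endpoints s = 0 and s = t are immaterial. *)
definition caputo_deriv :: "real \<Rightarrow> (real \<Rightarrow> real) \<Rightarrow> real \<Rightarrow> real" where
  "caputo_deriv \<gamma> u t =
     (if \<gamma> = 1 then deriv u t
      else 1 / Gamma (1 - \<gamma>) * integral {0..t} (\<lambda>s. deriv u s / (t - s) powr \<gamma>))"

(* Functions whose Caputo derivative of order \<gamma> genuinely exists at every t > 0. The derivative
   of u is not required to exist at 0: solutions of order \<alpha> < 1 behave like t powr \<alpha> there. *)
definition caputo_differentiable :: "real \<Rightarrow> (real \<Rightarrow> real) \<Rightarrow> bool" where
  "caputo_differentiable \<gamma> u \<longleftrightarrow>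
     continuous_on {0..} u \<and>
     (\<forall>t>0. u differentiable (at t)) \<and>
     (\<gamma> \<noteq> 1 \<longrightarrow> (\<forall>t>0. (\<lambda>s. deriv u s / (t - s) powr \<gamma>) absolutely_integrable_on {0..t}))"

(* The equations are imposed for t > 0 only: for order < 1 the integral defining the Caputo
   derivative is empty at t = 0, so they would fail there in general. *)
definition mixed_index_solution ::
    "real \<Rightarrow> real \<Rightarrow> real \<Rightarrow> real \<Rightarrow> real \<Rightarrow> real \<Rightarrow> real^2 \<Rightarrow> (real \<Rightarrow> real^2) \<Rightarrow> bool" where
  "mixed_index_solution \<alpha> \<beta> a1 a2 b1 b2 y0 y \<longleftrightarrow>
     caputo_differentiable \<alpha> (\<lambda>t. y t $ 1) \<and>
     caputo_differentiable \<beta> (\<lambda>t. y t $ 2) \<and>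
     y 0 = y0 \<and>
     (\<forall>t>0. caputo_deriv \<alpha> (\<lambda>t. y t $ 1) t = a1 * y t $ 1 + a2 * y t $ 2 \<and>
            caputo_deriv \<beta> (\<lambda>t. y t $ 2) t = b1 * y t $ 1 + b2 * y t $ 2)"

definition complex_vec :: "real^'n \<Rightarrow> complex^'n" where
  "complex_vec v = (\<chi> i. complex_of_real (v $ i))"

definition mixed_char_fun :: "nat \<Rightarrow> real \<Rightarrow> real \<Rightarrow> real \<Rightarrow> complex \<Rightarrow> complex" where
  "mixed_char_fun K a1 b2 DA w =
     w ^ (K + 1) - of_real a1 * w ^ K - of_real b2 * w + of_real DA"

definition mixed_partial_fractions ::
    "nat \<Rightarrow> real \<Rightarrow> real \<Rightarrow> real \<Rightarrow> real \<Rightarrow> real \<Rightarrow> real^2 \<Rightarrow>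
     (nat \<Rightarrow> complex) \<Rightarrow> (nat \<Rightarrow> complex^2) \<Rightarrow> bool" where
  "mixed_partial_fractions K a1 a2 b1 b2 DA y0 lam A \<longleftrightarrow>
     (\<forall>w. w \<notin> lam ` {1..K+1} \<longrightarrow>
        (\<Sum>j=1..K+1. (1 / (w - lam j)) *s A j) =
        (1 / mixed_char_fun K a1 b2 DA w) *s
          (w ^ K *s complex_vec y0
           + (w ^ (K - 1) * of_real (y0 $ 2)) *s complex_vec (vector [a2, - a1])
           + of_real (y0 $ 1) *s complex_vec (vector [- b2, b1])))"

end

theory Submission
  imports Defs
begin

text \<open>
  Put \<open>c k = (\<Sum>j. \<lambda>\<^sub>j ^ k A\<^sub>j)\<close>. Substituting \<open>w = 1/x\<close> in the partial fraction identity turns it into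
  an identity of power series in \<open>x\<close>, whose coefficients say that \<open>c 0 = y(0)\<close>, that
  \<open>c\<^sub>1 (k + 1) = a\<^sub>1 c\<^sub>1 k + a\<^sub>2 c\<^sub>2 k\<close>, that \<open>c\<^sub>2 (k + K) = b\<^sub>1 c\<^sub>1 k + b\<^sub>2 c\<^sub>2 k\<close>, and that \<open>c\<^sub>2 k = 0\<close> for
  \<open>0 < k < K\<close>. In particular the \<open>c k\<close> are real. The proposed solution is
  \<open>\<Sum>k. c k t\<^bsup>k\<alpha>\<^esup> / \<Gamma>(1 + k\<alpha>)\<close>, and the Caputo derivative of order \<open>K\<alpha>\<close> shifts the coefficients of
  such a series by \<open>K\<close> as soon as the coefficients with index strictly between \<open>0\<close> and \<open>K\<close> vanish
  (they would produce singular terms). So the recurrence is exactly the differential system.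

  For uniqueness, Fubini and the Beta integral invert the Caputo derivative, so the difference of two
  solutions satisfies a homogeneous linear Volterra equation with weakly singular kernels. For large
  \<open>R\<close> its integral operator is a contraction in the supremum norm weighted by
  \<open>E\<^sub>\<alpha>(R t\<^sup>\<alpha>)\<close>, because the fractional integral of order \<open>K\<alpha>\<close> of this weight is at most
  \<open>R\<^bsup>-K\<^esup>\<close> times the weight.
\<close>

section \<open>Power series in fractional powers\<close>

text \<open>The affine substitution \<open>s = x + (y - x) * t\<close> carries the Beta integral
  over the unit interval to \<open>{x..y}\<close>. It evaluates all Abel-type kernels below.\<close>

lemma has_integral_Beta_interval:
  fixes a b x y :: real
  assumes ab: "a > 0" "b > 0" and xy: "x < y"
  shows "((\<lambda>s. (s - x) powr (a - 1) * (y - s) powr (b - 1)) has_integral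
           (y - x) powr (a + b - 1) * Beta a b) {x..y}"
proof -
  define m where "m = inverse (y - x)"
  have m: "m > 0" using xy by (simp add: m_def)
  have "((\<lambda>t. t powr (a - 1) * (1 - t) powr (b - 1)) has_integral Beta a b) (cbox 0 1)"
    using has_integral_Beta_real[OF ab] by simp
  from has_integral_affinity'[OF this m, of "- x * m"]
  have "((\<lambda>s. (m * s - x * m) powr (a - 1) * (1 - (m * s - x * m)) powr (b - 1))
          has_integral Beta a b / m) {x * m / m..(1 + x * m) / m}"
    by (simp add: divide_inverse mult.commute)
  moreover have "x * m / m = x" "(1 + x * m) / m = y" "Beta a b / m = Beta a b * (y - x)"
    using m by (simp_all add: add_divide_distrib) (simp_all add: m_def divide_inverse)
  ultimately have *: "((\<lambda>s. (m * s - x * m) powr (a - 1) * (1 - (m * s - x * m)) powr (b - 1))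
          has_integral Beta a b * (y - x)) {x..y}"
    by simp
  \<comment> \<open>This factor clears the denominators \<open>y - x\<close> of the two rescaled
    powers; the Jacobian then raises the exponent to \<open>a + b - 1\<close>.\<close>
  have "((\<lambda>s. (y - x) powr (a + b - 2) *
           ((m * s - x * m) powr (a - 1) * (1 - (m * s - x * m)) powr (b - 1)))
          has_integral (y - x) powr (a + b - 2) * (Beta a b * (y - x))) {x..y}"
    by (rule has_integral_mult_right[OF *])
  also have "(y - x) powr (a + b - 2) * (Beta a b * (y - x)) = (y - x) powr (a + b - 1) * Beta a b"
    using xy powr_add[of "y - x" "a + b - 2" 1] by simp
  finally show ?thesis
  proof (rule has_integral_eq[rotated])
    fix s assume s: "s \<in> {x..y}"
    have e: "m * s - x * m = (s - x) / (y - x)"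
      by (simp add: m_def divide_inverse algebra_simps)
    moreover have "1 - (m * s - x * m) = (y - s) / (y - x)"
      unfolding e using xy by (simp add: field_simps)
    moreover have "(y - x) powr (a + b - 2) = (y - x) powr (a - 1) * (y - x) powr (b - 1)"
      by (simp flip: powr_add)
    ultimately show "(y - x) powr (a + b - 2) *
        ((m * s - x * m) powr (a - 1) * (1 - (m * s - x * m)) powr (b - 1)) =
        (s - x) powr (a - 1) * (y - s) powr (b - 1)"
      using s xy by (simp add: powr_divide)
  qed
qed

text \<open>Euler's integral is cut down to \<open>{M..}\<close>, where \<open>t powr x\<close> is
  at least \<open>M powr x\<close>. As \<open>M\<close> is free, Gamma outgrows every geometric
  sequence.\<close>

lemma Gamma_lower_bound:
  fixes x M :: real
  assumes "x \<ge> 0" "M > 0"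
  shows "M powr x * exp (- M) \<le> Gamma (1 + x)"
proof -
  have 1: "((\<lambda>t. t powr x / exp t) has_integral Gamma (1 + x)) {0..}"
    using Gamma_integral_real[of "1 + x"] assms by simp
  have 2: "((\<lambda>t. M powr x * exp (-1 * t)) has_integral M powr x * (exp (-1 * M) / 1)) {M..}"
    by (intro has_integral_mult_right has_integral_exp_minus_to_infinity) simp
  have 3: "((\<lambda>t. if t \<in> {M..} then M powr x * exp (-1 * t) else 0) has_integral
      M powr x * (exp (-1 * M) / 1)) {0..}"
    using 2 assms by (subst has_integral_restrict) auto
  have "M powr x * (exp (-1 * M) / 1) \<le> Gamma (1 + x)"
    by (rule has_integral_le[OF 3 1])
       (use assms in \<open>auto simp: exp_minus field_simps intro!: powr_mono2\<close>)
  then show ?thesis by simp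
qed

lemma summable_power_div_Gamma:
  fixes R \<alpha> :: real
  assumes "\<alpha> > 0"
  shows "summable (\<lambda>k. R ^ k / Gamma (1 + \<alpha> * real k))"
proof -
  \<comment> \<open>Chosen so that \<open>M powr \<alpha>\<close> exceeds
    \<open>2 * \<bar>R\<bar>\<close>, which leaves a geometric majorant of ratio 1/2; the summand 1
    keeps \<open>M\<close> positive for \<open>R = 0\<close>.\<close>
  define M where "M = (2 * \<bar>R\<bar> + 1) powr (1 / \<alpha>)"
  have M: "M > 0" "M powr \<alpha> = 2 * \<bar>R\<bar> + 1"
    using assms by (auto simp: M_def powr_powr)
  have "summable (\<lambda>k. exp M * (1/2) ^ k :: real)"
    by (intro summable_mult summable_geometric) simp
  then show ?thesis
  proof (rule summable_comparison_test'[where N = 0])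
    fix k :: nat
    have "(2 * \<bar>R\<bar> + 1) ^ k * exp (- M) \<le> Gamma (1 + \<alpha> * real k)"
      using Gamma_lower_bound[of "\<alpha> * real k" M] assms M
      by (simp add: powr_powr[symmetric] powr_realpow)
    moreover have "(2 * \<bar>R\<bar>) ^ k \<le> (2 * \<bar>R\<bar> + 1) ^ k"
      by (intro power_mono) auto
    ultimately have "(2 * \<bar>R\<bar>) ^ k * exp (- M) \<le> Gamma (1 + \<alpha> * real k)"
      by (smt (verit) exp_gt_zero mult_right_mono)
    moreover have "Gamma (1 + \<alpha> * real k) > 0"
      using assms by (intro Gamma_real_pos) (simp add: add_pos_nonneg)
    ultimately show "norm (R ^ k / Gamma (1 + \<alpha> * real k)) \<le> exp M * (1/2) ^ k"
      by (simp add: abs_mult power_abs power_mult_distrib exp_minus field_simps)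
  qed
qed

text \<open>The growth class of power sums of the eigenvalues. After division by the Gamma factors
  such coefficients give everywhere convergent series.\<close>

definition geom_bounded :: "(nat \<Rightarrow> real) \<Rightarrow> bool" where
  "geom_bounded c \<longleftrightarrow> (\<exists>C R. \<forall>k. \<bar>c k\<bar> \<le> C * R ^ k)"

lemma geom_bounded_shift: "geom_bounded c \<Longrightarrow> geom_bounded (\<lambda>k. c (k + m))"
  unfolding geom_bounded_def
proof (elim exE)
  fix C R assume "\<forall>k. \<bar>c k\<bar> \<le> C * R ^ k"
  moreover have "C * R ^ (k + m) = (C * R ^ m) * R ^ k" for k
    by (simp add: power_add)
  ultimately have "\<forall>k. \<bar>c (k + m)\<bar> \<le> (C * R ^ m) * R ^ k"
    by metis
  then show "\<exists>C R. \<forall>k. \<bar>c (k + m)\<bar> \<le> C * R ^ k" by blast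
qed

lemma geom_bounded_abs: "geom_bounded c \<Longrightarrow> geom_bounded (\<lambda>k. \<bar>c k\<bar>)"
  by (simp add: geom_bounded_def)

text \<open>For \<open>c k = r ^ k\<close> this is the Mittag-Leffler function at
  \<open>r * t powr \<alpha>\<close>. The form \<open>(t powr \<alpha>) ^ k\<close> makes results on
  ordinary power series applicable and gives the constant term its right value at
  \<open>t = 0\<close>, where \<open>0 powr 0\<close> would be 0.\<close>

definition frac_powser :: "real \<Rightarrow> (nat \<Rightarrow> real) \<Rightarrow> real \<Rightarrow> real" where
  "frac_powser \<alpha> c t = (\<Sum>k. c k / Gamma (1 + \<alpha> * real k) * (t powr \<alpha>) ^ k)"

lemma summable_frac_powser:
  assumes "geom_bounded c" "\<alpha> > 0"
  shows "summable (\<lambda>k. c k / Gamma (1 + \<alpha> * real k) * x ^ k)"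
proof -
  obtain C R where CR: "\<And>k. \<bar>c k\<bar> \<le> C * R ^ k"
    using assms by (auto simp: geom_bounded_def)
  have "summable (\<lambda>k. C * ((R * \<bar>x\<bar>) ^ k / Gamma (1 + \<alpha> * real k)))"
    by (intro summable_mult summable_power_div_Gamma assms)
  then show ?thesis
  proof (rule summable_comparison_test'[where N = 0])
    fix k :: nat
    have "Gamma (1 + \<alpha> * real k) > 0"
      using assms by (intro Gamma_real_pos) (simp add: add_pos_nonneg)
    then show "norm (c k / Gamma (1 + \<alpha> * real k) * x ^ k)
        \<le> C * ((R * \<bar>x\<bar>) ^ k / Gamma (1 + \<alpha> * real k))"
      using mult_right_mono[OF CR[of k], of "\<bar>x\<bar> ^ k"]
      by (simp add: abs_mult power_abs power_mult_distrib divide_right_mono mult_ac)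
  qed
qed

lemma frac_powser_0: "frac_powser \<alpha> c 0 = c 0"
  using powser_zero[of "\<lambda>k. c k / Gamma (1 + \<alpha> * real k)"] by (simp add: frac_powser_def)

lemma continuous_on_frac_powser:
  assumes "geom_bounded c" "\<alpha> > 0"
  shows "continuous_on {0..} (frac_powser \<alpha> c)"
proof -
  have "continuous_on UNIV (\<lambda>x. \<Sum>k. c k / Gamma (1 + \<alpha> * real k) * x ^ k)"
    using isCont_powser_converges_everywhere[OF summable_frac_powser[OF assms]]
    by (simp add: continuous_at_imp_continuous_on)
  moreover have "continuous_on {0..} (\<lambda>t. t powr \<alpha>)"
    using assms by (intro continuous_on_powr') auto
  ultimately have "continuous_on {0..} ((\<lambda>x. \<Sum>k. c k / Gamma (1 + \<alpha> * real k) * x ^ k) \<circ> (\<lambda>t. t powr \<alpha>))"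
    by (meson continuous_on_compose continuous_on_subset subset_UNIV)
  then show ?thesis by (simp add: frac_powser_def[abs_def] o_def)
qed

text \<open>Chain rule for an everywhere convergent power series at \<open>t powr \<alpha>\<close>.
  The factor \<open>\<alpha> * real (Suc k)\<close> it produces is absorbed by the functional
  equation of Gamma.\<close>

lemma frac_powser_deriv:
  assumes c: "geom_bounded c" and \<alpha>: "\<alpha> > 0" and t: "t > 0"
  shows "frac_powser \<alpha> c differentiable (at t)"
    and "(\<lambda>k. c (Suc k) / Gamma (\<alpha> * real (Suc k)) * t powr (\<alpha> * real (Suc k) - 1))
           sums deriv (frac_powser \<alpha> c) t"
proof -
  define a where "a k = c k / Gamma (1 + \<alpha> * real k)" for k
  have sm: "summable (\<lambda>k. a k * x ^ k)" for x
    using summable_frac_powser[OF c \<alpha>] by (simp add: a_def)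
  have "((\<lambda>t. t powr \<alpha>) has_real_derivative \<alpha> * t powr (\<alpha> - 1)) (at t)"
    using t by (auto intro!: derivative_eq_intros)
  from DERIV_chain2[OF termdiffs_strong_converges_everywhere[OF sm] this]
  have "((\<lambda>t. \<Sum>k. a k * (t powr \<alpha>) ^ k) has_real_derivative
      (\<Sum>n. diffs a n * (t powr \<alpha>) ^ n) * (\<alpha> * t powr (\<alpha> - 1))) (at t)" .
  moreover have eq: "frac_powser \<alpha> c = (\<lambda>t. \<Sum>k. a k * (t powr \<alpha>) ^ k)"
    by (simp add: fun_eq_iff frac_powser_def a_def)
  ultimately have D: "(frac_powser \<alpha> c has_real_derivative
      (\<Sum>n. diffs a n * (t powr \<alpha>) ^ n) * (\<alpha> * t powr (\<alpha> - 1))) (at t)"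
    by (simp add: eq)
  then show "frac_powser \<alpha> c differentiable (at t)"
    using real_differentiable_def by blast
  have "summable (\<lambda>n. diffs a n * (t powr \<alpha>) ^ n)"
    by (rule termdiff_converges_all[OF sm])
  from sums_mult2[OF summable_sums[OF this], of "\<alpha> * t powr (\<alpha> - 1)"] DERIV_imp_deriv[OF D]
  have "(\<lambda>n. diffs a n * (t powr \<alpha>) ^ n * (\<alpha> * t powr (\<alpha> - 1))) sums deriv (frac_powser \<alpha> c) t"
    by simp
  moreover have "diffs a n * (t powr \<alpha>) ^ n * (\<alpha> * t powr (\<alpha> - 1)) =
      c (Suc n) / Gamma (\<alpha> * real (Suc n)) * t powr (\<alpha> * real (Suc n) - 1)" for n
  proof -
    have "\<alpha> * real (Suc n) > 0" using \<alpha> by simp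
    then have "Gamma (1 + \<alpha> * real (Suc n)) = \<alpha> * real (Suc n) * Gamma (\<alpha> * real (Suc n))"
      by (subst add.commute, intro Gamma_plus1) (metis nonpos_Ints_nonpos not_le)
    moreover have "(t powr \<alpha>) ^ n * t powr (\<alpha> - 1) = t powr (\<alpha> * real (Suc n) - 1)"
      using t by (simp add: powr_realpow[symmetric] powr_powr powr_add[symmetric] algebra_simps)
    ultimately show ?thesis
      using \<alpha> by (simp add: diffs_def a_def del: of_nat_Suc)
  qed
  ultimately show "(\<lambda>k. c (Suc k) / Gamma (\<alpha> * real (Suc k)) * t powr (\<alpha> * real (Suc k) - 1))
           sums deriv (frac_powser \<alpha> c) t"
    by simp
qed

section \<open>Caputo derivatives of fractional power series\<close>

lemma has_integral_frac_powser_term: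
  fixes \<alpha> \<gamma> t :: real
  assumes "\<alpha> > 0" "\<gamma> < 1" "t > 0"
  shows "((\<lambda>s. s powr (\<alpha> * real (Suc k) - 1) * (t - s) powr - \<gamma> / Gamma (\<alpha> * real (Suc k)))
    has_integral Gamma (1 - \<gamma>) * t powr (\<alpha> * real (Suc k) - \<gamma>) /
      Gamma (1 + (\<alpha> * real (Suc k) - \<gamma>))) {0..t}"
proof -
  have a: "\<alpha> * real (Suc k) > 0" using assms by simp
  then have "Gamma (\<alpha> * real (Suc k)) > 0" by (rule Gamma_real_pos)
  \<comment> \<open>Beta integral on \<open>{0..t}\<close> with parameters
    \<open>\<alpha> * real (Suc k)\<close> and \<open>1 - \<gamma>\<close>; the Gamma value of the
    first cancels against the normalisation.\<close>
  then show ?thesis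
    using has_integral_divide[OF has_integral_Beta_interval[OF a, of "1 - \<gamma>" 0 t],
        of "Gamma (\<alpha> * real (Suc k))"] assms
    by (simp add: Beta_def field_simps)
qed

text \<open>The differentiated series is integrated term by term against the kernel. Each term is a
  Beta integral, and subtracting \<open>real K * \<alpha>\<close> from the exponent moves it by
  \<open>K\<close> places.\<close>

lemma frac_powser_caputo_less_1:
  assumes c: "geom_bounded c" and \<alpha>: "\<alpha> > 0" and \<gamma>: "real K * \<alpha> < 1" and K: "K > 0"
    and z: "\<And>k. 0 < k \<Longrightarrow> k < K \<Longrightarrow> c k = 0" and t: "t > 0"
  shows "(\<lambda>s. deriv (frac_powser \<alpha> c) s / (t - s) powr (real K * \<alpha>)) absolutely_integrable_on {0..t}"
    and "integral {0..t} (\<lambda>s. deriv (frac_powser \<alpha> c) s / (t - s) powr (real K * \<alpha>)) =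
           Gamma (1 - real K * \<alpha>) * frac_powser \<alpha> (\<lambda>k. c (k + K)) t"
proof -
  define \<gamma> where "\<gamma> = real K * \<alpha>"
  define M where "M = lebesgue_on {0..t}"
  define h where "h k s = s powr (\<alpha> * real (Suc k) - 1) * (t - s) powr - \<gamma> / Gamma (\<alpha> * real (Suc k))"
    for k s
  define I where "I k = Gamma (1 - \<gamma>) * t powr (\<alpha> * real (Suc k) - \<gamma>) /
      Gamma (1 + (\<alpha> * real (Suc k) - \<gamma>))" for k
  have \<gamma>1: "\<gamma> < 1" using \<gamma> by (simp add: \<gamma>_def)
  have h_pos: "h k s \<ge> 0" for k s
    using \<alpha> by (auto simp: h_def intro!: mult_nonneg_nonneg divide_nonneg_nonneg Gamma_real_nonneg)
  have hI: "(h k has_integral I k) {0..t}" for k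
    using has_integral_frac_powser_term[OF \<alpha> \<gamma>1 t, of k] by (simp add: h_def[abs_def] I_def)
  have hint: "integrable M (h k)" for k
    unfolding M_def using hI h_pos
    by (intro absolutely_integrable_imp_integrable nonnegative_absolutely_integrable_1) auto
  have hL: "integral\<^sup>L M (h k) = I k" for k
    using lebesgue_integral_eq_integral[of "{0..t}" "h k"] hint[of k] hI[of k]
    by (simp add: M_def integral_unique)
  \<comment> \<open>Stated for a general \<open>d\<close>: with \<open>d = c\<close> it gives the
    value, and with the absolute values of \<open>c\<close> the summability that justifies the
    interchange. As \<open>I k\<close> belongs to coefficient \<open>Suc k\<close>, the
    \<open>K - 1\<close> vanishing terms in front are dropped.\<close>
  have S: "(\<lambda>k. d (Suc k) * I k) sums (Gamma (1 - \<gamma>) * frac_powser \<alpha> (\<lambda>k. d (k + K)) t)"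
    if d: "geom_bounded d" and d0: "\<And>k. 0 < k \<Longrightarrow> k < K \<Longrightarrow> d k = 0" for d
  proof -
    have "(\<lambda>k. Gamma (1 - \<gamma>) * (d (k + K) / Gamma (1 + \<alpha> * real k) * (t powr \<alpha>) ^ k)) sums
        (Gamma (1 - \<gamma>) * frac_powser \<alpha> (\<lambda>k. d (k + K)) t)"
      unfolding frac_powser_def
      by (intro sums_mult summable_sums summable_frac_powser geom_bounded_shift d \<alpha>)
    moreover have "Gamma (1 - \<gamma>) * (d (k + K) / Gamma (1 + \<alpha> * real k) * (t powr \<alpha>) ^ k) =
        d (Suc (k + (K - 1))) * I (k + (K - 1))" for k
    proof -
      have e: "Suc (k + (K - 1)) = k + K" using K by simp
      have "\<alpha> * real (k + K) - \<gamma> = \<alpha> * real k" by (simp add: \<gamma>_def algebra_simps)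
      then show ?thesis
        unfolding I_def e using t by (simp add: powr_powr[symmetric] powr_realpow)
    qed
    ultimately have "(\<lambda>k. d (Suc (k + (K - 1))) * I (k + (K - 1))) sums
        (Gamma (1 - \<gamma>) * frac_powser \<alpha> (\<lambda>k. d (k + K)) t)"
      by simp
    then show ?thesis
      by (subst (asm) sums_zero_iff_shift[where f = "\<lambda>k. d (Suc k) * I k"]) (auto simp: d0)
  qed
  have dsum: "(\<lambda>k. d (Suc k) * h k s) sums (deriv (frac_powser \<alpha> d) s / (t - s) powr \<gamma>)"
    if d: "geom_bounded d" and s: "0 < s" for d s
    using sums_mult2[OF frac_powser_deriv(2)[OF d \<alpha> s], of "(t - s) powr - \<gamma>"]
    by (simp add: h_def powr_minus_divide mult_ac)
  have sm: "summable (\<lambda>k. norm (c (Suc k) * h k s))" if "s \<in> {0..t}" for s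
  proof (cases "s = 0")
    \<comment> \<open>At \<open>s = 0\<close> every \<open>h k s\<close> is 0, since
      \<open>0 powr\<close> any exponent is 0.\<close>
    case True
    then show ?thesis by (simp add: h_def)
  next
    case False
    then show ?thesis
      using sums_summable[OF dsum[OF geom_bounded_abs[OF c], of s]] that h_pos by (simp add: abs_mult)
  qed
  have int: "integrable M (\<lambda>s. c (Suc k) * h k s)" for k
    by (intro integrable_mult_right hint)
  have AE: "AE s in M. summable (\<lambda>k. norm (c (Suc k) * h k s))"
    using sm by (auto simp: M_def intro!: AE_I2)
  have "(\<integral>s. norm (c (Suc k) * h k s) \<partial>M) = \<bar>c (Suc k)\<bar> * I k" for k
    using h_pos by (simp add: abs_mult hL)
  moreover have "summable (\<lambda>k. \<bar>c (Suc k)\<bar> * I k)"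
    using S[OF geom_bounded_abs[OF c]] z by (auto simp: sums_iff)
  ultimately have sums: "summable (\<lambda>k. \<integral>s. norm (c (Suc k) * h k s) \<partial>M)"
    by simp
  define g where "g s = (\<Sum>k. c (Suc k) * h k s)" for s
  have gint: "integrable M g"
    unfolding g_def[abs_def] by (rule integrable_suminf[OF int AE sums])
  have "integral\<^sup>L M g = (\<Sum>k. c (Suc k) * I k)"
    unfolding g_def[abs_def] by (subst integral_suminf[OF int AE sums]) (simp add: hL)
  also have "\<dots> = Gamma (1 - \<gamma>) * frac_powser \<alpha> (\<lambda>k. c (k + K)) t"
    using S[OF c] z by (simp add: sums_iff)
  finally have gI: "(g has_integral Gamma (1 - \<gamma>) * frac_powser \<alpha> (\<lambda>k. c (k + K)) t) {0..t}"
    using has_integral_integral_lebesgue_on[of "{0..t}" g] gint by (simp add: M_def)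
  have g_abs: "g absolutely_integrable_on {0..t}"
    using gint integrable_restrict_space[of "{0..t}" lebesgue g]
    by (simp add: M_def set_integrable_def)
  define D where "D s = deriv (frac_powser \<alpha> c) s / (t - s) powr \<gamma>" for s
  \<comment> \<open>The termwise derivative is known only for \<open>s > 0\<close>; the single point
    0 is negligible.\<close>
  have g_eq: "D s = g s" if "s \<in> {0..t} - {0}" for s
    using dsum[OF c, of s] that by (simp add: g_def D_def sums_iff)
  have "D absolutely_integrable_on {0..t}"
    by (rule absolutely_integrable_spike[OF g_abs negligible_sing g_eq])
  then show "(\<lambda>s. deriv (frac_powser \<alpha> c) s / (t - s) powr (real K * \<alpha>)) absolutely_integrable_on {0..t}"
    by (simp add: D_def[abs_def] \<gamma>_def)
  have "finite {0 :: real}" by simp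
  from integral_unique[OF has_integral_spike_finite[OF this g_eq gI]]
  show "integral {0..t} (\<lambda>s. deriv (frac_powser \<alpha> c) s / (t - s) powr (real K * \<alpha>)) =
           Gamma (1 - real K * \<alpha>) * frac_powser \<alpha> (\<lambda>k. c (k + K)) t"
    by (simp add: D_def[abs_def] \<gamma>_def)
qed

text \<open>The order 1 case needs no integral: lowering the exponent of \<open>t\<close> by 1 is
  lowering the power of \<open>t powr \<alpha>\<close> by \<open>K\<close>.\<close>

lemma frac_powser_deriv_eq_1:
  assumes c: "geom_bounded c" and \<alpha>: "\<alpha> > 0" and \<gamma>: "real K * \<alpha> = 1" and K: "K > 0"
    and z: "\<And>k. 0 < k \<Longrightarrow> k < K \<Longrightarrow> c k = 0" and t: "t > 0"
  shows "deriv (frac_powser \<alpha> c) t = frac_powser \<alpha> (\<lambda>k. c (k + K)) t"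
proof -
  define f where "f k = c (Suc k) / Gamma (\<alpha> * real (Suc k)) * t powr (\<alpha> * real (Suc k) - 1)" for k
  have "f sums deriv (frac_powser \<alpha> c) t"
    using frac_powser_deriv(2)[OF c \<alpha> t] by (simp add: f_def[abs_def])
  then have "(\<lambda>k. f (k + (K - 1))) sums deriv (frac_powser \<alpha> c) t"
    by (subst sums_zero_iff_shift) (auto simp: f_def z)
  moreover have "f (k + (K - 1)) = c (k + K) / Gamma (1 + \<alpha> * real k) * (t powr \<alpha>) ^ k" for k
  proof -
    have e: "Suc (k + (K - 1)) = k + K" using K by simp
    have "\<alpha> * real (k + K) = 1 + \<alpha> * real k" using \<gamma> by (simp add: algebra_simps)
    then show ?thesis
      unfolding f_def e using t by (simp add: powr_powr[symmetric] powr_realpow)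
  qed
  ultimately show ?thesis
    by (simp add: sums_iff frac_powser_def)
qed

lemma frac_powser_caputo:
  assumes c: "geom_bounded c" and \<alpha>: "\<alpha> > 0" and \<gamma>: "real K * \<alpha> \<le> 1" and K: "K > 0"
    and z: "\<And>k. 0 < k \<Longrightarrow> k < K \<Longrightarrow> c k = 0"
  shows "caputo_differentiable (real K * \<alpha>) (frac_powser \<alpha> c)"
    and "t > 0 \<Longrightarrow> caputo_deriv (real K * \<alpha>) (frac_powser \<alpha> c) t = frac_powser \<alpha> (\<lambda>k. c (k + K)) t"
proof -
  show "caputo_differentiable (real K * \<alpha>) (frac_powser \<alpha> c)"
    unfolding caputo_differentiable_def
    using frac_powser_caputo_less_1(1)[OF c \<alpha> _ K z] \<gamma>
      continuous_on_frac_powser[OF c \<alpha>] frac_powser_deriv(1)[OF c \<alpha>] by auto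
  show "caputo_deriv (real K * \<alpha>) (frac_powser \<alpha> c) t = frac_powser \<alpha> (\<lambda>k. c (k + K)) t" if t: "t > 0"
  proof (cases "real K * \<alpha> = 1")
    case True
    then show ?thesis
      using frac_powser_deriv_eq_1[OF c \<alpha> True K z t] by (simp add: caputo_deriv_def)
  next
    case False
    then have "Gamma (1 - real K * \<alpha>) \<noteq> 0"
      using \<gamma> Gamma_real_pos[of "1 - real K * \<alpha>"] by linarith
    then show ?thesis
      using False frac_powser_caputo_less_1(2)[OF c \<alpha> _ K z t] \<gamma> by (simp add: caputo_deriv_def)
  qed
qed

section \<open>Inverting the Caputo derivative\<close>

text \<open>A bridge to Fubini on the product of Borel measures: \<open>g\<close> is a Borel version
  of \<open>f\<close>, extended by zero and allowed to differ at finitely many points.\<close>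

lemma absolutely_integrable_imp_lborel:
  fixes f g :: "real \<Rightarrow> real"
  assumes f: "f absolutely_integrable_on S" and g: "g \<in> borel_measurable borel"
    and N: "finite N" "\<And>x. x \<in> S - N \<Longrightarrow> g x = f x" and out: "\<And>x. x \<notin> S \<Longrightarrow> g x = 0"
  shows "integrable lborel g" "integral\<^sup>L lborel g = integral S f"
proof -
  have "g absolutely_integrable_on S"
    by (rule absolutely_integrable_spike[OF f negligible_finite[OF N(1)] N(2)])
  moreover have "(\<lambda>x. indicator S x *\<^sub>R g x) = g"
    using out by (auto simp: fun_eq_iff indicator_def)
  ultimately have "integrable lebesgue g"
    by (simp add: set_integrable_def)
  then show gi: "integrable lborel g"
    using g by (simp add: integrable_completion)
  have "integral\<^sup>L lborel g = integral UNIV g"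
    using has_integral_integral_lborel[OF gi] by (simp add: integral_unique)
  also have "(\<lambda>x. if x \<in> S then g x else 0) = g"
    using out by auto
  then have "integral UNIV g = integral S g"
    using integral_restrict_UNIV[of S g] by simp
  also have "\<dots> = integral S f"
    by (rule integral_spike[OF negligible_finite[OF N(1)]]) (use N(2) in auto)
  finally show "integral\<^sup>L lborel g = integral S f" .
qed

text \<open>On the open interval the derivative is the pointwise limit of difference quotients with
  step \<open>1 / real (Suc n)\<close>, which are continuous there.\<close>

lemma borel_measurable_indicator_deriv:
  fixes u :: "real \<Rightarrow> real"
  assumes u: "\<And>t. t > 0 \<Longrightarrow> u differentiable (at t)"
  shows "(\<lambda>x. indicator {0<..<t} x * deriv u x) \<in> borel_measurable borel"
proof (rule borel_measurable_LIMSEQ_real)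
  have cont: "isCont u x" if "x > 0" for x
    using differentiable_imp_continuous_within[OF u[OF that]] .
  show "(\<lambda>x. indicator {0<..<t} x *\<^sub>R ((u (x + 1 / real (Suc n)) - u x) / (1 / real (Suc n))))
      \<in> borel_measurable borel" for n
  proof (rule borel_measurable_continuous_on_indicator)
    have "isCont (\<lambda>x. (u (x + 1 / real (Suc n)) - u x) / (1 / real (Suc n))) x" if "x > 0" for x
      using that by (intro continuous_intros isCont_o2[OF _ cont] cont) (auto simp: add_pos_pos)
    then show "continuous_on {0<..<t} (\<lambda>x. (u (x + 1 / real (Suc n)) - u x) / (1 / real (Suc n)))"
      by (intro continuous_at_imp_continuous_on) auto
  qed simp
  show "(\<lambda>n. indicator {0<..<t} x *\<^sub>R ((u (x + 1 / real (Suc n)) - u x) / (1 / real (Suc n))))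
      \<longlonglongrightarrow> indicator {0<..<t} x * deriv u x" for x
  proof (cases "x \<in> {0<..<t}")
    case True
    then have "(u has_real_derivative deriv u x) (at x)"
      using u by (simp add: DERIV_deriv_iff_real_differentiable)
    then have "((\<lambda>h. (u (x + h) - u x) / h) \<longlongrightarrow> deriv u x) (at 0)"
      by (simp add: DERIV_def)
    moreover have "filterlim (\<lambda>n. 1 / real (Suc n)) (at 0) sequentially"
      unfolding filterlim_at using LIMSEQ_Suc[OF lim_1_over_n] by auto
    ultimately show ?thesis
      using True filterlim_compose by fastforce
  qed simp
qed

lemma caputo_differentiable_deriv_absolutely_integrable:
  assumes u: "caputo_differentiable \<gamma> u" and \<gamma>: "0 < \<gamma>" "\<gamma> < 1" and t: "t > 0"
  shows "deriv u absolutely_integrable_on {0..t}"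
proof -
  \<comment> \<open>The kernel with endpoint \<open>2 * t\<close> is continuous and positive on \<open>{0..t}\<close>, so it can be divided out.\<close>
  have "(\<lambda>s. deriv u s / (2 * t - s) powr \<gamma>) absolutely_integrable_on {0..2 * t}"
    using u \<gamma> t by (auto simp: caputo_differentiable_def)
  then have "(\<lambda>s. deriv u s / (2 * t - s) powr \<gamma>) absolutely_integrable_on {0..t}"
    by (rule set_integrable_subset) (use t in auto)
  moreover have c: "continuous_on {0..t} (\<lambda>s. (2 * t - s) powr \<gamma>)"
    using t by (intro continuous_intros) auto
  moreover have "(\<lambda>s. (2 * t - s) powr \<gamma>) \<in> borel_measurable (lebesgue_on {0..t})"
    by (rule continuous_imp_measurable_on_sets_lebesgue[OF c]) auto
  moreover have "bounded ((\<lambda>s. (2 * t - s) powr \<gamma>) ` {0..t})"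
    by (intro compact_imp_bounded compact_continuous_image c) auto
  ultimately have "(\<lambda>s. (2 * t - s) powr \<gamma> * (deriv u s / (2 * t - s) powr \<gamma>)) absolutely_integrable_on {0..t}"
    by (intro absolutely_integrable_bounded_measurable_product_real) auto
  then show ?thesis
    by (rule absolutely_integrable_spike[OF _ negligible_empty]) (use t in auto)
qed

lemma caputo_inverse_less_1:
  assumes u: "caputo_differentiable \<gamma> u" and \<gamma>: "0 < \<gamma>" "\<gamma> < 1" and t: "t > 0"
  shows "((\<lambda>s. (t - s) powr (\<gamma> - 1) * caputo_deriv \<gamma> u s) has_integral
           Gamma \<gamma> * (u t - u 0)) {0..t}"
proof -
  define v where "v x = indicator {0<..<t} x * deriv u x" for x
  define b where "b x s = indicator {x<..<t} s * ((s - x) powr - \<gamma> * (t - s) powr (\<gamma> - 1))" for x s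
  define B where "B = Gamma (1 - \<gamma>) * Gamma \<gamma>"
  \<comment> \<open>Fubini is applied to \<open>v x * b x s\<close>. The kernel \<open>b x\<close> has the Beta integral \<open>B\<close> for every \<open>x < t\<close>,
    which gives integrability on the product.\<close>
  have G: "Gamma (1 - \<gamma>) \<noteq> 0" using Gamma_real_pos[of "1 - \<gamma>"] \<gamma> by linarith
  have cont: "continuous_on {0..t} u" and diff: "\<And>s. s > 0 \<Longrightarrow> u differentiable (at s)"
    and ai: "\<And>s. s > 0 \<Longrightarrow> (\<lambda>x. deriv u x / (s - x) powr \<gamma>) absolutely_integrable_on {0..s}"
    using u \<gamma> by (auto simp: caputo_differentiable_def intro: continuous_on_subset)
  have v_meas[measurable]: "v \<in> borel_measurable borel"
    unfolding v_def[abs_def] by (rule borel_measurable_indicator_deriv[OF diff])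
  note v_lborel = absolutely_integrable_imp_lborel[OF
      caputo_differentiable_deriv_absolutely_integrable[OF u \<gamma> t] v_meas, of "{0, t}"]
  have v_int: "integrable lborel v"
    by (rule v_lborel(1)) (auto simp: v_def)
  have "integral\<^sup>L lborel v = integral {0..t} (deriv u)"
    by (rule v_lborel(2)) (auto simp: v_def)
  \<comment> \<open>Differentiability in the open interval and continuity up to the endpoints
    suffice; the derivative at 0 may fail to exist.\<close>
  also have "(deriv u has_integral u t - u 0) {0..t}"
    using t diff cont
    by (intro fundamental_theorem_of_calculus_interior)
       (auto simp: has_real_derivative_iff_has_vector_derivative[symmetric]
          DERIV_deriv_iff_real_differentiable)
  then have "integral {0..t} (deriv u) = u t - u 0" by (rule integral_unique)
  finally have v_eq: "integral\<^sup>L lborel v = u t - u 0" .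
  have b_pos: "b x s \<ge> 0" for x s by (simp add: b_def)
  have b_meas[measurable]: "b x \<in> borel_measurable borel" for x
    unfolding b_def[abs_def] by measurable
  have b: "integrable lborel (b x) \<and> integral\<^sup>L lborel (b x) = B" if "x < t" for x
  proof -
    let ?f = "\<lambda>s. (s - x) powr (1 - \<gamma> - 1) * (t - s) powr (\<gamma> - 1)"
    have f: "(?f has_integral B) {x..t}"
      using has_integral_Beta_interval[of "1 - \<gamma>" \<gamma> x t] \<gamma> that by (simp add: Beta_def B_def)
    then have "?f absolutely_integrable_on {x..t}"
      by (intro nonnegative_absolutely_integrable_1) auto
    note * = absolutely_integrable_imp_lborel[OF this b_meas[of x], of "{x, t}"]
    have "integrable lborel (b x)"
      by (rule *(1)) (auto simp: b_def)
    moreover have "integral\<^sup>L lborel (b x) = integral {x..t} ?f"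
      by (rule *(2)) (auto simp: b_def)
    ultimately show ?thesis
      using integral_unique[OF f] by simp
  qed
  define f where "f x s = v x * b x s" for x s
  have f_meas: "case_prod f \<in> borel_measurable (lborel \<Otimes>\<^sub>M lborel)"
    unfolding f_def b_def indicator_def greaterThanLessThan_iff by measurable
  \<comment> \<open>For \<open>x \<ge> t\<close> the factor \<open>v x\<close> vanishes, so the Beta
    value \<open>B\<close> is needed only below \<open>t\<close>.\<close>
  have f_int: "integrable lborel (f x) \<and> (\<integral>s. norm (f x s) \<partial>lborel) = norm (v x) * B
      \<and> (\<integral>s. f x s \<partial>lborel) = v x * B" for x
    using b[of x] b_pos by (cases "x < t") (auto simp: f_def[abs_def] v_def abs_mult)
  have f_prod: "integrable (lborel \<Otimes>\<^sub>M lborel) (case_prod f)"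
    using f_meas by (rule lborel_pair.Fubini_integrable) (use f_int v_int in auto)
  define g where "g s = (\<integral>x. f x s \<partial>lborel)" for s
  have "integrable lborel g"
    using lborel_pair.integrable_snd[OF f_prod] by (simp add: g_def[abs_def])
  \<comment> \<open>Integrating in \<open>s\<close> first yields the constant \<open>B\<close> times
    the integral of \<open>v\<close>.\<close>
  moreover have "integral\<^sup>L lborel g = B * (u t - u 0)"
    using lborel_pair.Fubini_integral[OF f_prod] f_int v_eq by (simp add: g_def[abs_def] mult.commute)
  ultimately have gI: "(g has_integral B * (u t - u 0)) UNIV"
    using has_integral_integral_lborel[of g] by simp
  \<comment> \<open>Integrating in \<open>x\<close> first yields the Caputo derivative at
    \<open>s\<close>. Only \<open>x = 0\<close> is exceptional: at \<open>x = s\<close> both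
    integrands are 0, by division by zero.\<close>
  have g_in: "g s = Gamma (1 - \<gamma>) * ((t - s) powr (\<gamma> - 1) * caputo_deriv \<gamma> u s)"
    if s: "s \<in> {0<..<t}" for s
  proof -
    define q where "q x = indicator {0<..<s} x * v x * (s - x) powr - \<gamma>" for x
    have q_meas: "q \<in> borel_measurable borel"
      unfolding q_def[abs_def] by measurable
    have "integral\<^sup>L lborel q = integral {0..s} (\<lambda>x. deriv u x / (s - x) powr \<gamma>)"
      by (rule absolutely_integrable_imp_lborel(2)[OF ai q_meas, of s "{0}"])
         (use s in \<open>auto simp: q_def v_def powr_minus_divide indicator_def\<close>)
    moreover have "f x s = (t - s) powr (\<gamma> - 1) * q x" for x
      using s by (auto simp: f_def b_def q_def v_def indicator_def)
    then have "g s = (t - s) powr (\<gamma> - 1) * integral\<^sup>L lborel q"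
      by (simp add: g_def)
    ultimately show ?thesis
      using G \<gamma> by (simp add: caputo_deriv_def)
  qed
  have g_out: "g s = 0" if "s \<notin> {0<..<t}" for s
  proof -
    have "f x s = 0" for x using that by (auto simp: f_def b_def v_def indicator_def)
    then show ?thesis by (simp add: g_def)
  qed
  have "g = (\<lambda>s. if s \<in> {0..t} then g s else 0)"
    using g_out by (auto simp: fun_eq_iff)
  then have "(g has_integral B * (u t - u 0)) {0..t}"
    using gI has_integral_restrict_UNIV by metis
  then have "((\<lambda>s. g s / Gamma (1 - \<gamma>)) has_integral B * (u t - u 0) / Gamma (1 - \<gamma>)) {0..t}"
    by (rule has_integral_divide)
  moreover have "B * (u t - u 0) / Gamma (1 - \<gamma>) = Gamma \<gamma> * (u t - u 0)"
    using G by (simp add: B_def)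
  ultimately show ?thesis
    using has_integral_spike_finite[of "{0, t}" "{0..t}" "\<lambda>s. (t - s) powr (\<gamma> - 1) * caputo_deriv \<gamma> u s"
        "\<lambda>s. g s / Gamma (1 - \<gamma>)"] g_in G by simp
qed

lemma caputo_inverse:
  assumes u: "caputo_differentiable \<gamma> u" and \<gamma>: "0 < \<gamma>" "\<gamma> \<le> 1" and t: "t > 0"
  shows "((\<lambda>s. (t - s) powr (\<gamma> - 1) * caputo_deriv \<gamma> u s) has_integral
           Gamma \<gamma> * (u t - u 0)) {0..t}"
proof (cases "\<gamma> = 1")
  case True
  have "(deriv u has_integral u t - u 0) {0..t}"
    using t u
    by (intro fundamental_theorem_of_calculus_interior)
       (auto simp: caputo_differentiable_def has_real_derivative_iff_has_vector_derivative[symmetric]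
          DERIV_deriv_iff_real_differentiable intro: continuous_on_subset)
  \<comment> \<open>The kernel \<open>(t - s) powr 0\<close> equals 1 except at
    \<open>s = t\<close>, where it is 0; that point is spiked out.\<close>
  then show ?thesis
    using True has_integral_spike_finite[of "{t}" "{0..t}" "\<lambda>s. (t - s) powr (\<gamma> - 1) * caputo_deriv \<gamma> u s" "deriv u"]
    by (simp add: caputo_deriv_def)
next
  case False
  then show ?thesis using caputo_inverse_less_1[OF u] \<gamma> t by simp
qed

text \<open>This turns a Caputo equation imposed for positive times into a Volterra integral
  equation.\<close>

lemma caputo_inverse_eq:
  assumes u: "caputo_differentiable \<gamma> u" and \<gamma>: "0 < \<gamma>" "\<gamma> \<le> 1" and t: "t > 0"
    and f: "\<And>s. s > 0 \<Longrightarrow> caputo_deriv \<gamma> u s = f s"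
  shows "((\<lambda>s. (t - s) powr (\<gamma> - 1) * f s) has_integral Gamma \<gamma> * (u t - u 0)) {0..t}"
proof (rule has_integral_spike_finite[OF _ _ caputo_inverse[OF u \<gamma> t]])
  show "finite {0 :: real}" by simp
qed (simp add: f)

section \<open>Uniqueness\<close>

lemma geom_bounded_power: "geom_bounded (\<lambda>k. R ^ k)"
  unfolding geom_bounded_def by (intro exI[of _ 1] exI[of _ "\<bar>R\<bar>"]) (simp add: power_abs)

lemma frac_powser_mono:
  assumes "geom_bounded c" "geom_bounded d" "\<alpha> > 0" "\<And>k. c k \<le> d k"
  shows "frac_powser \<alpha> c t \<le> frac_powser \<alpha> d t"
  unfolding frac_powser_def
proof (intro suminf_le summable_frac_powser assms)
  fix k :: nat
  have "Gamma (1 + \<alpha> * real k) > 0"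
    using assms by (intro Gamma_real_pos) (simp add: add_pos_nonneg)
  then show "c k / Gamma (1 + \<alpha> * real k) * (t powr \<alpha>) ^ k \<le> d k / Gamma (1 + \<alpha> * real k) * (t powr \<alpha>) ^ k"
    using assms(4)[of k] by (intro mult_right_mono divide_right_mono) auto
qed

lemma frac_powser_power_ge_1:
  assumes "\<alpha> > 0" "R \<ge> 0"
  shows "1 \<le> frac_powser \<alpha> (\<lambda>k. R ^ k) t"
proof -
  have "frac_powser \<alpha> (\<lambda>k. if k = 0 then 1 else 0) t =
      (\<Sum>k. if k = 0 then 1 else 0)"
    unfolding frac_powser_def by (intro suminf_cong) auto
  also have "\<dots> = (1 :: real)"
    using suminf_finite[of "{0}" "\<lambda>k. if k = 0 then 1 else 0 :: real"] by simp
  finally have "frac_powser \<alpha> (\<lambda>k. if k = 0 then 1 else 0) t = 1" .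
  moreover have "geom_bounded (\<lambda>k. if k = 0 then 1 else 0)"
    unfolding geom_bounded_def by (intro exI[of _ 1]) auto
  ultimately show ?thesis
    using frac_powser_mono[OF _ geom_bounded_power assms(1), of "\<lambda>k. if k = 0 then 1 else 0" R t] assms by auto
qed

lemma frac_powser_mult: "frac_powser \<alpha> (\<lambda>k. a * c k) t = a * frac_powser \<alpha> c t"
  if "geom_bounded c" "\<alpha> > 0"
  using suminf_mult[OF summable_frac_powser[OF that], of a "t powr \<alpha>"]
  by (simp add: frac_powser_def mult_ac)

lemma frac_integral_frac_powser_power:
  assumes \<alpha>: "\<alpha> > 0" and K: "K > 0" "real K * \<alpha> \<le> 1" and R: "R > 0" and t: "t > 0"
  obtains I where "((\<lambda>s. (t - s) powr (real K * \<alpha> - 1) * frac_powser \<alpha> (\<lambda>k. R ^ k) s) has_integral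
        Gamma (real K * \<alpha>) * I) {0..t}"
    and "I \<le> frac_powser \<alpha> (\<lambda>k. R ^ k) t / R ^ K"
proof
  \<comment> \<open>The Caputo derivative shifts coefficients by \<open>K\<close>, so the fractional integral of the series
    with coefficients \<open>R ^ k\<close> is read off from the series with coefficients \<open>c\<close>.\<close>
  define c where "c k = (if k < K then 0 else R ^ (k - K))" for k
  have c_le: "c k \<le> R ^ k / R ^ K" for k
    using R by (auto simp: c_def power_diff)
  have gb: "geom_bounded c"
    unfolding geom_bounded_def
    using c_le R by (intro exI[of _ "1 / R ^ K"] exI[of _ R]) (auto simp: c_def)
  have shift: "(\<lambda>k. c (k + K)) = (\<lambda>k. R ^ k)" by (simp add: c_def fun_eq_iff)
  have c0: "c k = 0" if "0 < k" "k < K" for k using that by (simp add: c_def)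
  \<comment> \<open>The zero initial value removes the boundary term of the inversion
    formula.\<close>
  have "frac_powser \<alpha> c 0 = 0" using K by (simp add: frac_powser_0 c_def)
  moreover have K\<alpha>: "0 < real K * \<alpha>" using \<alpha> K by simp
  ultimately show "((\<lambda>s. (t - s) powr (real K * \<alpha> - 1) * frac_powser \<alpha> (\<lambda>k. R ^ k) s) has_integral
        Gamma (real K * \<alpha>) * frac_powser \<alpha> c t) {0..t}"
    using caputo_inverse_eq[OF frac_powser_caputo(1)[OF gb \<alpha> K(2,1) c0] K\<alpha> K(2) t
        frac_powser_caputo(2)[OF gb \<alpha> K(2,1) c0]]
    by (simp add: shift)
  have "geom_bounded (\<lambda>k. 1 / R ^ K * R ^ k)"
    unfolding geom_bounded_def by (intro exI[of _ "1 / R ^ K"] exI[of _ R]) (use R in auto)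
  then have "frac_powser \<alpha> c t \<le> frac_powser \<alpha> (\<lambda>k. 1 / R ^ K * R ^ k) t"
    using c_le by (intro frac_powser_mono gb \<alpha>) auto
  then show "frac_powser \<alpha> c t \<le> frac_powser \<alpha> (\<lambda>k. R ^ k) t / R ^ K"
    by (subst (asm) frac_powser_mult[OF geom_bounded_power \<alpha>]) simp
qed

text \<open>The contraction estimate: a bound by \<open>M\<close> times the weight passes through
  the fractional integral and gains a factor \<open>1 / R ^ K\<close>. Weakening it to
  \<open>1 / R\<close> gives both equations the same rate.\<close>

lemma frac_integral_bound:
  assumes \<alpha>: "\<alpha> > 0" and K: "K > 0" "real K * \<alpha> \<le> 1" and R: "R \<ge> 1" and t: "t > 0"
    and I: "((\<lambda>s. (t - s) powr (real K * \<alpha> - 1) * (p * z1 s + q * z2 s)) has_integral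
        Gamma (real K * \<alpha>) * z) {0..t}"
    and le: "\<And>s. s \<in> {0..t} \<Longrightarrow> \<bar>z1 s\<bar> + \<bar>z2 s\<bar> \<le> M * frac_powser \<alpha> (\<lambda>k. R ^ k) s"
    and M: "M \<ge> 0"
  shows "\<bar>z\<bar> \<le> (\<bar>p\<bar> + \<bar>q\<bar>) * M * frac_powser \<alpha> (\<lambda>k. R ^ k) t / R"
proof -
  define E where "E = frac_powser \<alpha> (\<lambda>k. R ^ k)"
  define C where "C = \<bar>p\<bar> + \<bar>q\<bar>"
  have C: "C * M \<ge> 0" using M by (simp add: C_def)
  obtain J where J: "((\<lambda>s. (t - s) powr (real K * \<alpha> - 1) * E s) has_integral Gamma (real K * \<alpha>) * J) {0..t}"
    and JE: "J \<le> E t / R ^ K"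
    unfolding E_def by (rule frac_integral_frac_powser_power[OF \<alpha> K _ t, of R]) (use R in auto)
  have G: "Gamma (real K * \<alpha>) > 0" using K \<alpha> by (intro Gamma_real_pos) simp
  note CJ = has_integral_mult_right[OF J, of "C * M"]
  have "norm (integral {0..t} (\<lambda>s. (t - s) powr (real K * \<alpha> - 1) * (p * z1 s + q * z2 s)))
      \<le> integral {0..t} (\<lambda>s. C * M * ((t - s) powr (real K * \<alpha> - 1) * E s))"
  proof (rule integral_norm_bound_integral)
    fix s assume s: "s \<in> {0..t}"
    have "\<bar>p * z1 s + q * z2 s\<bar> \<le> \<bar>p\<bar> * \<bar>z1 s\<bar> + \<bar>q\<bar> * \<bar>z2 s\<bar>"
      by (metis abs_mult abs_triangle_ineq)
    also have "\<dots> \<le> C * (\<bar>z1 s\<bar> + \<bar>z2 s\<bar>)"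
      by (simp add: C_def algebra_simps)
    also have "\<dots> \<le> C * (M * E s)"
      using le[OF s] by (intro mult_left_mono) (auto simp: C_def E_def)
    finally show "norm ((t - s) powr (real K * \<alpha> - 1) * (p * z1 s + q * z2 s))
        \<le> C * M * ((t - s) powr (real K * \<alpha> - 1) * E s)"
      using mult_left_mono[of "\<bar>p * z1 s + q * z2 s\<bar>" "C * (M * E s)" "(t - s) powr (real K * \<alpha> - 1)"]
      by (simp add: abs_mult mult_ac)
  qed (use I CJ in \<open>auto simp: integrable_on_def\<close>)
  then have "\<bar>Gamma (real K * \<alpha>) * z\<bar> \<le> C * M * (Gamma (real K * \<alpha>) * J)"
    unfolding integral_unique[OF I] integral_unique[OF CJ] real_norm_def .
  then have "Gamma (real K * \<alpha>) * \<bar>z\<bar> \<le> Gamma (real K * \<alpha>) * (C * M * J)"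
    unfolding abs_mult abs_of_pos[OF G] by (simp only: mult_ac)
  then have "\<bar>z\<bar> \<le> C * M * J" using G by (metis mult_le_cancel_left_pos)
  also have "\<dots> \<le> C * M * (E t / R)"
  proof (rule mult_left_mono[OF order_trans[OF JE] C])
    have "E t \<ge> 1" unfolding E_def using frac_powser_power_ge_1[OF \<alpha>] R by simp
    moreover have "R \<le> R ^ K" using R K self_le_power by blast
    ultimately show "E t / R ^ K \<le> E t / R" using R by (intro divide_left_mono) auto
  qed
  finally show ?thesis by (simp add: C_def E_def)
qed

lemma volterra_zero:
  assumes \<alpha>: "0 < \<alpha>" "\<alpha> \<le> 1" and K: "K > 0" "real K * \<alpha> \<le> 1"
    and cont: "continuous_on {0..} z1" "continuous_on {0..} z2" and z0: "z1 0 = 0" "z2 0 = 0"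
    and I1: "\<And>t. t > 0 \<Longrightarrow> ((\<lambda>s. (t - s) powr (\<alpha> - 1) * (a1 * z1 s + a2 * z2 s)) has_integral
        Gamma \<alpha> * z1 t) {0..t}"
    and I2: "\<And>t. t > 0 \<Longrightarrow> ((\<lambda>s. (t - s) powr (real K * \<alpha> - 1) * (b1 * z1 s + b2 * z2 s)) has_integral
        Gamma (real K * \<alpha>) * z2 t) {0..t}"
    and T: "T \<ge> (0::real)"
  shows "z1 T = 0 \<and> z2 T = 0"
proof -
  \<comment> \<open>In the norm weighted by \<open>E\<close>, the integral operators contract by a factor below \<open>1/2\<close>.\<close>
  define R where "R = 2 * (\<bar>a1\<bar> + \<bar>a2\<bar> + \<bar>b1\<bar> + \<bar>b2\<bar>) + 1"
  define E where "E = frac_powser \<alpha> (\<lambda>k. R ^ k)"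
  have R: "R \<ge> 1" by (simp add: R_def)
  have E: "E t \<ge> 1" for t
    unfolding E_def using frac_powser_power_ge_1[OF \<alpha>(1)] R by simp
  have E': "E t \<noteq> 0" for t using E[of t] by linarith
  define \<phi> where "\<phi> t = (\<bar>z1 t\<bar> + \<bar>z2 t\<bar>) / E t" for t
  have "continuous_on {0..T} \<phi>"
    unfolding \<phi>_def using E' cont continuous_on_frac_powser[OF geom_bounded_power \<alpha>(1), of R]
    by (intro continuous_intros) (auto simp: E_def intro: continuous_on_subset)
  \<comment> \<open>At a maximiser \<open>t\<close> the value \<open>\<phi> t\<close> is itself an
    admissible constant \<open>M\<close> on \<open>{0..t}\<close>, so the estimate bounds
    \<open>\<phi> t\<close> by a fraction of itself.\<close>
  then obtain t where t: "t \<in> {0..T}" and max: "\<And>s. s \<in> {0..T} \<Longrightarrow> \<phi> s \<le> \<phi> t"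
    using continuous_attains_sup[of "{0..T}" \<phi>] T by auto
  have "\<phi> t = 0"
  proof (cases "t = 0")
    case True
    then show ?thesis by (simp add: \<phi>_def z0)
  next
    case False
    with t have t0: "t > 0" by simp
    have pos: "\<phi> t \<ge> 0" using E[of t] by (simp add: \<phi>_def)
    have le: "\<bar>z1 s\<bar> + \<bar>z2 s\<bar> \<le> \<phi> t * frac_powser \<alpha> (\<lambda>k. R ^ k) s" if "s \<in> {0..t}" for s
      using max[of s] that t E[of s] by (simp add: \<phi>_def E_def divide_le_eq)
    have "\<bar>z1 t\<bar> \<le> (\<bar>a1\<bar> + \<bar>a2\<bar>) * \<phi> t * E t / R"
      using frac_integral_bound[where K = 1, OF \<alpha>(1) _ _ R t0 _ le pos] I1[OF t0] \<alpha>
      by (simp add: E_def)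
    moreover have "\<bar>z2 t\<bar> \<le> (\<bar>b1\<bar> + \<bar>b2\<bar>) * \<phi> t * E t / R"
      using frac_integral_bound[OF \<alpha>(1) K R t0 I2[OF t0] le pos]
      by (simp add: E_def)
    ultimately have "\<bar>z1 t\<bar> + \<bar>z2 t\<bar> \<le> (\<bar>a1\<bar> + \<bar>a2\<bar> + \<bar>b1\<bar> + \<bar>b2\<bar>) * \<phi> t * E t / R"
      by (simp add: add_divide_distrib distrib_right)
    \<comment> \<open>By the choice of \<open>R\<close> the sum of the four absolute values is
      \<open>(R - 1) / 2\<close>.\<close>
    also have "\<dots> = (R - 1) / (2 * R) * \<phi> t * E t"
      by (simp add: R_def field_simps)
    finally have "\<phi> t \<le> (R - 1) / (2 * R) * \<phi> t"
      unfolding \<phi>_def[of t] using E[of t] by (simp add: divide_le_eq)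
    also have "\<dots> \<le> 1 / 2 * \<phi> t"
      using R pos by (intro mult_right_mono) (auto simp: field_simps)
    finally show ?thesis using pos by simp
  qed
  with max[of T] T have "\<phi> T \<le> 0" by simp
  with E[of T] have "\<bar>z1 T\<bar> + \<bar>z2 T\<bar> \<le> 0"
    by (simp add: \<phi>_def divide_le_0_iff)
  then show ?thesis by linarith
qed

text \<open>Both solutions satisfy the same linear Volterra system with the same initial value,
  which cancels in the difference.\<close>

lemma mixed_index_solution_unique:
  assumes \<alpha>: "0 < \<alpha>" "\<alpha> \<le> 1" and K: "K > 0" "real K * \<alpha> \<le> 1"
    and y: "mixed_index_solution \<alpha> (real K * \<alpha>) a1 a2 b1 b2 y0 y"
    and x: "mixed_index_solution \<alpha> (real K * \<alpha>) a1 a2 b1 b2 y0 x" and T: "T \<ge> 0"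
  shows "y T = x T"
proof -
  have K\<alpha>: "0 < real K * \<alpha>" using \<alpha> K by simp
  have V: "((\<lambda>s. (t - s) powr (\<alpha> - 1) * (a1 * u s $ 1 + a2 * u s $ 2)) has_integral
        Gamma \<alpha> * (u t $ 1 - y0 $ 1)) {0..t} \<and>
      ((\<lambda>s. (t - s) powr (real K * \<alpha> - 1) * (b1 * u s $ 1 + b2 * u s $ 2)) has_integral
        Gamma (real K * \<alpha>) * (u t $ 2 - y0 $ 2)) {0..t}"
    if u: "mixed_index_solution \<alpha> (real K * \<alpha>) a1 a2 b1 b2 y0 u" and t: "t > 0" for u t
  proof
    have cd: "caputo_differentiable \<alpha> (\<lambda>t. u t $ 1)" "caputo_differentiable (real K * \<alpha>) (\<lambda>t. u t $ 2)"
      and eq: "\<And>s. s > 0 \<Longrightarrow> caputo_deriv \<alpha> (\<lambda>t. u t $ 1) s = a1 * u s $ 1 + a2 * u s $ 2"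
        "\<And>s. s > 0 \<Longrightarrow> caputo_deriv (real K * \<alpha>) (\<lambda>t. u t $ 2) s = b1 * u s $ 1 + b2 * u s $ 2"
      and u0: "u 0 = y0"
      using u by (auto simp: mixed_index_solution_def)
    show "((\<lambda>s. (t - s) powr (\<alpha> - 1) * (a1 * u s $ 1 + a2 * u s $ 2)) has_integral
        Gamma \<alpha> * (u t $ 1 - y0 $ 1)) {0..t}"
      using caputo_inverse_eq[OF cd(1) \<alpha> t eq(1)] by (simp add: u0)
    show "((\<lambda>s. (t - s) powr (real K * \<alpha> - 1) * (b1 * u s $ 1 + b2 * u s $ 2)) has_integral
        Gamma (real K * \<alpha>) * (u t $ 2 - y0 $ 2)) {0..t}"
      using caputo_inverse_eq[OF cd(2) K\<alpha> K(2) t eq(2)] by (simp add: u0)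
  qed
  have "y T $ 1 - x T $ 1 = 0 \<and> y T $ 2 - x T $ 2 = 0"
  proof (rule volterra_zero[OF \<alpha> K _ _ _ _ _ _ T])
    show "continuous_on {0..} (\<lambda>t. y t $ 1 - x t $ 1)" "continuous_on {0..} (\<lambda>t. y t $ 2 - x t $ 2)"
      using x y by (auto simp: mixed_index_solution_def caputo_differentiable_def intro!: continuous_on_diff)
    show "y 0 $ 1 - x 0 $ 1 = 0" "y 0 $ 2 - x 0 $ 2 = 0"
      using x y by (auto simp: mixed_index_solution_def)
    show "((\<lambda>s. (t - s) powr (\<alpha> - 1) * (a1 * (y s $ 1 - x s $ 1) + a2 * (y s $ 2 - x s $ 2)))
        has_integral Gamma \<alpha> * (y t $ 1 - x t $ 1)) {0..t}" if "t > 0" for t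
      using has_integral_diff[OF conjunct1[OF V[OF y that]] conjunct1[OF V[OF x that]]]
      by (simp add: algebra_simps)
    show "((\<lambda>s. (t - s) powr (real K * \<alpha> - 1) * (b1 * (y s $ 1 - x s $ 1) + b2 * (y s $ 2 - x s $ 2)))
        has_integral Gamma (real K * \<alpha>) * (y t $ 2 - x t $ 2)) {0..t}" if "t > 0" for t
      using has_integral_diff[OF conjunct2[OF V[OF y that]] conjunct2[OF V[OF x that]]]
      by (simp add: algebra_simps)
  qed
  then show ?thesis
    by (simp add: vec_eq_iff forall_2)
qed

section \<open>Partial fractions and the coefficient recurrence\<close>

text \<open>Lagrange interpolation: \<open>q\<close> is the interpolant of \<open>p\<close> at the
  distinct nodes \<open>r j\<close>, and both degrees are below the number of nodes, so
  \<open>q = p\<close>.\<close>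

lemma partial_fractions_exist:
  fixes p :: "'a :: field poly" and r :: "'b \<Rightarrow> 'a"
  assumes fin: "finite I" and inj: "inj_on r I" and deg: "degree p < card I"
  shows "\<exists>a. \<forall>w. w \<notin> r ` I \<longrightarrow> (\<Sum>j\<in>I. a j / (w - r j)) = poly p w / (\<Prod>j\<in>I. (w - r j))"
proof -
  define a where "a j = poly p (r j) / (\<Prod>i\<in>I - {j}. (r j - r i))" for j
  define q where "q = (\<Sum>j\<in>I. smult (a j) (\<Prod>i\<in>I - {j}. [:- r i, 1:]))"
  have card: "card (r ` I) = card I" using inj by (rule card_image)
  have pos: "card I > 0" using deg by simp
  have "degree q \<le> card I - 1"
    unfolding q_def
  proof (rule degree_sum_le[OF fin])
    fix j assume j: "j \<in> I"
    have "degree (smult (a j) (\<Prod>i\<in>I - {j}. [:- r i, 1:])) \<le> degree (\<Prod>i\<in>I - {j}. [:- r i, 1:])"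
      by (rule degree_smult_le)
    also have "\<dots> \<le> (\<Sum>i\<in>I - {j}. degree [:- r i, 1:])"
      using degree_prod_sum_le[of "I - {j}" "\<lambda>i. [:- r i, 1:]"] fin by (simp add: o_def)
    also have "\<dots> = card I - 1" using fin j by simp
    finally show "degree (smult (a j) (\<Prod>i\<in>I - {j}. [:- r i, 1:])) \<le> card I - 1" .
  qed
  with pos have degq: "degree q < card (r ` I)" by (simp add: card)
  have "q = p"
  proof (rule poly_eqI_degree[of "r ` I"])
    fix x assume "x \<in> r ` I"
    then obtain l where l: "l \<in> I" "x = r l" by blast
    have "poly q x = (\<Sum>j\<in>I. a j * (\<Prod>i\<in>I - {j}. (r l - r i)))"
      by (simp add: q_def poly_sum poly_prod l)
    also have "\<dots> = (\<Sum>j\<in>I. if j = l then a l * (\<Prod>i\<in>I - {l}. (r l - r i)) else 0)"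
      using fin l by (intro sum.cong) (auto simp: prod_zero_iff)
    also have "\<dots> = a l * (\<Prod>i\<in>I - {l}. (r l - r i))"
      using fin l by simp
    also have "\<dots> = poly p x"
      using fin l inj by (auto simp: a_def prod_zero_iff inj_on_def)
    finally show "poly q x = poly p x" .
  qed (use degq deg card in auto)
  have "(\<Sum>j\<in>I. a j / (w - r j)) = poly p w / (\<Prod>j\<in>I. (w - r j))" if w: "w \<notin> r ` I" for w
  proof -
    have "a j / (w - r j) = a j * (\<Prod>i\<in>I - {j}. (w - r i)) / (\<Prod>j\<in>I. (w - r j))" if "j \<in> I" for j
    proof -
      have "(\<Prod>i\<in>I - {j}. (w - r i)) \<noteq> 0" "w - r j \<noteq> 0"
        using w that fin by (auto simp: prod_zero_iff)
      then show ?thesis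
        unfolding prod.remove[OF fin that, of "\<lambda>i. w - r i"] by simp
    qed
    then have "(\<Sum>j\<in>I. a j / (w - r j)) = poly q w / (\<Prod>j\<in>I. (w - r j))"
      by (simp add: q_def poly_sum poly_prod sum_divide_distrib)
    then show ?thesis using \<open>q = p\<close> by simp
  qed
  then show ?thesis by blast
qed

lemma mixed_partial_fractions_iff:
  "mixed_partial_fractions K a1 a2 b1 b2 DA y0 lam A \<longleftrightarrow>
     (\<forall>w. w \<notin> lam ` {1..K+1} \<longrightarrow>
       (\<Sum>j=1..K+1. A j $ 1 / (w - lam j)) =
         (w ^ K * of_real (y0 $ 1) + w ^ (K - 1) * of_real (y0 $ 2) * of_real a2
           - of_real (y0 $ 1) * of_real b2) / mixed_char_fun K a1 b2 DA w \<and>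
       (\<Sum>j=1..K+1. A j $ 2 / (w - lam j)) =
         (w ^ K * of_real (y0 $ 2) - w ^ (K - 1) * of_real (y0 $ 2) * of_real a1
           + of_real (y0 $ 1) * of_real b1) / mixed_char_fun K a1 b2 DA w)"
  unfolding mixed_partial_fractions_def vec_eq_iff forall_2
  by (simp add: complex_vec_def add_divide_distrib diff_divide_distrib del: sum.cl_ivl_Suc)

lemma mixed_partial_fractions_exist:
  assumes inj: "inj_on lam {1..K+1}"
    and P: "\<And>w. mixed_char_fun K a1 b2 DA w = (\<Prod>j=1..K+1. (w - lam j))"
  shows "\<exists>A. mixed_partial_fractions K a1 a2 b1 b2 DA y0 lam A"
proof -
  define p1 where "p1 = monom (complex_of_real (y0 $ 1)) K + monom (of_real (y0 $ 2) * of_real a2) (K - 1)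
      + [:- of_real (y0 $ 1) * of_real b2:]"
  define p2 where "p2 = monom (complex_of_real (y0 $ 2)) K + monom (- of_real (y0 $ 2) * of_real a1) (K - 1)
      + [:of_real (y0 $ 1) * of_real b1:]"
  have "degree p1 \<le> K" "degree p2 \<le> K"
    unfolding p1_def p2_def
    by (intro degree_add_le order.trans[OF degree_monom_le]; simp)+
  then have deg: "degree p1 < card {1..K+1}" "degree p2 < card {1..K+1}" by simp_all
  from partial_fractions_exist[OF _ inj deg(1)] partial_fractions_exist[OF _ inj deg(2)]
  obtain a b where ab: "\<And>w. w \<notin> lam ` {1..K+1} \<Longrightarrow>
      (\<Sum>j=1..K+1. a j / (w - lam j)) = poly p1 w / (\<Prod>j=1..K+1. (w - lam j))"
    "\<And>w. w \<notin> lam ` {1..K+1} \<Longrightarrow>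
      (\<Sum>j=1..K+1. b j / (w - lam j)) = poly p2 w / (\<Prod>j=1..K+1. (w - lam j))"
    by blast
  have "poly p1 w = w ^ K * of_real (y0 $ 1) + w ^ (K - 1) * of_real (y0 $ 2) * of_real a2
           - of_real (y0 $ 1) * of_real b2"
    "poly p2 w = w ^ K * of_real (y0 $ 2) - w ^ (K - 1) * of_real (y0 $ 2) * of_real a1
           + of_real (y0 $ 1) * of_real b1" for w
    by (simp_all add: p1_def p2_def poly_monom mult_ac)
  with ab have "mixed_partial_fractions K a1 a2 b1 b2 DA y0 lam (\<lambda>j. vector [a j, b j])"
    unfolding mixed_partial_fractions_iff P by simp
  then show ?thesis by blast
qed

section \<open>Generating functions and the coefficient recurrence\<close>

lemma has_fps_expansion_partial_fraction:
  fixes a r :: "'b \<Rightarrow> complex"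
  shows "(\<lambda>x. \<Sum>j\<in>I. a j / (1 - r j * x)) has_fps_expansion Abs_fps (\<lambda>k. \<Sum>j\<in>I. a j * r j ^ k)"
proof -
  have inv: "inverse (1 - fps_const c * fps_X) = Abs_fps (\<lambda>k. c ^ k)" for c :: complex
  proof (rule fps_inverse_unique)
    show "(1 - fps_const c * fps_X) * Abs_fps (\<lambda>k. c ^ k) = 1"
    proof (rule fps_ext)
      fix n show "fps_nth ((1 - fps_const c * fps_X) * Abs_fps (\<lambda>k. c ^ k)) n = fps_nth 1 n"
        by (cases n) (simp_all add: left_diff_distrib mult.assoc)
    qed
  qed
  have "(\<lambda>x. \<Sum>j\<in>I. a j * inverse (1 - r j * x)) has_fps_expansion
      (\<Sum>j\<in>I. fps_const (a j) * inverse (1 - fps_const (r j) * fps_X))"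
    by (intro fps_expansion_intros) auto
  moreover have "(\<Sum>j\<in>I. fps_const (a j) * inverse (1 - fps_const (r j) * fps_X)) =
      Abs_fps (\<lambda>k. \<Sum>j\<in>I. a j * r j ^ k)"
    by (rule fps_ext) (simp add: inv fps_sum_nth)
  ultimately show ?thesis by (simp add: divide_inverse)
qed

text \<open>Multiplying both functions by \<open>x\<close> makes them agree at 0 as well; the factor
  \<open>fps_X\<close> is cancelled afterwards.\<close>

lemma has_fps_expansion_eq_punctured:
  fixes f g :: "complex \<Rightarrow> complex"
  assumes f: "f has_fps_expansion F" and g: "g has_fps_expansion G"
    and eq: "eventually (\<lambda>x. x \<noteq> 0 \<longrightarrow> f x = g x) (nhds 0)"
  shows "F = G"
proof -
  have F: "(\<lambda>x. x * f x) has_fps_expansion fps_X * F"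
    and G: "(\<lambda>x. x * g x) has_fps_expansion fps_X * G"
    by (intro fps_expansion_intros f g)+
  have "eventually (\<lambda>x. eval_fps (fps_X * F) x = eval_fps (fps_X * G) x) (nhds 0)"
    using F[unfolded has_fps_expansion_def, THEN conjunct2] G[unfolded has_fps_expansion_def, THEN conjunct2] eq
    by eventually_elim auto
  then have "fps_X * F = fps_X * G"
    using F G by (intro eval_fps_eqD) (auto simp: has_fps_expansion_def)
  then show ?thesis by simp
qed

text \<open>The right-hand sides of the partial fraction identity are the Cramer solution of the
  Laplace-transformed 2 by 2 system, whose determinant is \<open>mixed_char_fun\<close>. The proof
  recovers that system and compares coefficients.\<close>

lemma mixed_recurrence:
  fixes A :: "nat \<Rightarrow> complex^2" and lam :: "nat \<Rightarrow> complex" and K :: nat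
  defines "c1 \<equiv> \<lambda>k. \<Sum>j=1..K+1. A j $ 1 * lam j ^ k"
    and "c2 \<equiv> \<lambda>k. \<Sum>j=1..K+1. A j $ 2 * lam j ^ k"
  assumes K: "0 < K" and DA: "DA = a1 * b2 - a2 * b1"
    and P: "\<And>w. mixed_char_fun K a1 b2 DA w = (\<Prod>j=1..K+1. (w - lam j))"
    and A: "mixed_partial_fractions K a1 a2 b1 b2 DA y0 lam A"
  shows "c1 0 = of_real (y0 $ 1)" "c2 0 = of_real (y0 $ 2)"
    and "c1 (Suc k) = of_real a1 * c1 k + of_real a2 * c2 k"
    and "0 < k \<Longrightarrow> k < K \<Longrightarrow> c2 k = 0"
    and "c2 (k + K) = of_real b1 * c1 k + of_real b2 * c2 k"
proof -
  define G1 where "G1 x = (\<Sum>j=1..K+1. A j $ 1 / (1 - lam j * x))" for x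
  define G2 where "G2 x = (\<Sum>j=1..K+1. A j $ 2 / (1 - lam j * x))" for x
  have E1: "G1 has_fps_expansion Abs_fps c1" and E2: "G2 has_fps_expansion Abs_fps c2"
    unfolding G1_def[abs_def] G2_def[abs_def] c1_def c2_def
    by (rule has_fps_expansion_partial_fraction)+
  have eqs: "G1 x = of_real (y0 $ 1) + x * (of_real a1 * G1 x + of_real a2 * G2 x) \<and>
      G2 x = of_real (y0 $ 2) + x ^ K * (of_real b1 * G1 x + of_real b2 * G2 x)"
    if x0: "x \<noteq> 0" and nx: "\<And>j. j \<in> {1..K+1} \<Longrightarrow> 1 - lam j * x \<noteq> 0" for x
  proof -
    define w where "w = inverse x"
    have w0: "w \<noteq> 0" and x: "x = inverse w" using x0 by (auto simp: w_def)
    have wl: "w - lam j \<noteq> 0" if "j \<in> {1..K+1}" for j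
      using nx[OF that] x0 by (auto simp: w_def field_simps)
    then have w: "w \<notin> lam ` {1..K+1}" by (metis imageE right_minus_eq)
    have P0: "mixed_char_fun K a1 b2 DA w \<noteq> 0"
      unfolding P using wl by (simp add: prod_zero_iff)
    have "a / (1 - lam j * x) = w * (a / (w - lam j))" if "j \<in> {1..K+1}" for a j
      using wl[OF that] w0 nx[OF that] by (simp add: x field_simps)
    then have G: "G1 x = w * (\<Sum>j=1..K+1. A j $ 1 / (w - lam j))"
        "G2 x = w * (\<Sum>j=1..K+1. A j $ 2 / (w - lam j))"
      unfolding G1_def G2_def sum_distrib_left by (auto intro!: sum.cong)
    \<comment> \<open>With \<open>W\<close> as an atom all powers of \<open>w\<close> become
      polynomial expressions and the truncated subtraction disappears.\<close>
    define W where "W = w ^ (K - 1)"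
    have wK: "w ^ K = w * W" using K by (simp add: W_def power_eq_if)
    define Q where "Q = w * (w * W) - of_real a1 * (w * W) - of_real b2 * w + of_real DA"
    have Q: "mixed_char_fun K a1 b2 DA w = Q"
      by (simp add: mixed_char_fun_def Q_def wK)
    have Q0: "Q \<noteq> 0" using P0 Q by simp
    note GQ = G[unfolded conjunct1[OF A[unfolded mixed_partial_fractions_iff, rule_format, OF w]]
        conjunct2[OF A[unfolded mixed_partial_fractions_iff, rule_format, OF w]] Q wK W_def[symmetric]]
    have xK: "x ^ K = inverse (w * W)"
      by (simp add: x power_inverse wK)
    have W0: "W \<noteq> 0" using w0 by (simp add: W_def)
    \<comment> \<open>The two rows of the transformed system; \<open>DA\<close> enters through the
      determinant \<open>Q\<close>.\<close>
    have "(w - of_real a1) * G1 x - of_real a2 * G2 x = of_real (y0 $ 1) * w"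
      "(w * W - of_real b2) * G2 x - of_real b1 * G1 x = of_real (y0 $ 2) * (w * W)"
      using Q0 unfolding GQ by (simp_all add: field_simps) (simp_all add: Q_def DA algebra_simps)
    then show ?thesis
      unfolding xK using w0 W0 by (simp add: x field_simps)
  qed
  \<comment> \<open>Near 0 no denominator vanishes, so \<open>eqs\<close> holds on a punctured
    neighbourhood.\<close>
  have ev: "eventually (\<lambda>x. \<forall>j\<in>{1..K+1}. 1 - lam j * x \<noteq> 0) (nhds 0)"
  proof (intro eventually_ball_finite ballI)
    fix j
    have "open {x. 1 - lam j * x \<noteq> 0}"
      by (intro open_Collect_neq continuous_intros)
    from eventually_nhds_in_open[OF this, of 0]
    show "eventually (\<lambda>x. 1 - lam j * x \<noteq> 0) (nhds 0)" by simp
  qed simp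
  have 1: "Abs_fps c1 = fps_const (of_real (y0 $ 1)) +
      fps_X * (fps_const (of_real a1) * Abs_fps c1 + fps_const (of_real a2) * Abs_fps c2)"
  proof (rule has_fps_expansion_eq_punctured[OF E1])
    show "(\<lambda>x. of_real (y0 $ 1) + x * (of_real a1 * G1 x + of_real a2 * G2 x)) has_fps_expansion
      fps_const (of_real (y0 $ 1)) + fps_X * (fps_const (of_real a1) * Abs_fps c1 + fps_const (of_real a2) * Abs_fps c2)"
      by (intro fps_expansion_intros E1 E2)
  qed (use ev in eventually_elim, use eqs in blast)
  have 2: "Abs_fps c2 = fps_const (of_real (y0 $ 2)) +
      fps_X ^ K * (fps_const (of_real b1) * Abs_fps c1 + fps_const (of_real b2) * Abs_fps c2)"
  proof (rule has_fps_expansion_eq_punctured[OF E2])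
    show "(\<lambda>x. of_real (y0 $ 2) + x ^ K * (of_real b1 * G1 x + of_real b2 * G2 x)) has_fps_expansion
      fps_const (of_real (y0 $ 2)) + fps_X ^ K * (fps_const (of_real b1) * Abs_fps c1 + fps_const (of_real b2) * Abs_fps c2)"
      by (intro fps_expansion_intros E1 E2)
  qed (use ev in eventually_elim, use eqs in blast)
  have n1: "c1 n = fps_nth (fps_const (of_real (y0 $ 1)) +
      fps_X * (fps_const (of_real a1) * Abs_fps c1 + fps_const (of_real a2) * Abs_fps c2)) n" for n
    by (subst 1[symmetric]) simp
  have n2: "c2 n = fps_nth (fps_const (of_real (y0 $ 2)) +
      fps_X ^ K * (fps_const (of_real b1) * Abs_fps c1 + fps_const (of_real b2) * Abs_fps c2)) n" for n
    by (subst 2[symmetric]) simp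
  show "c1 0 = of_real (y0 $ 1)" by (subst n1) simp
  show "c2 0 = of_real (y0 $ 2)" using K by (subst n2) (simp add: fps_X_power_mult_nth)
  show "c1 (Suc k) = of_real a1 * c1 k + of_real a2 * c2 k" by (subst n1) simp
  show "c2 k = 0" if "0 < k" "k < K" using that by (subst n2) (simp add: fps_X_power_mult_nth)
  show "c2 (k + K) = of_real b1 * c1 k + of_real b2 * c2 k"
    using K by (subst n2) (simp add: fps_X_power_mult_nth)
qed

section \<open>Mittag-Leffler sums and existence of the solution\<close>

lemma frac_powser_lincomb:
  assumes "geom_bounded c" "geom_bounded d" "\<alpha> > 0"
  shows "frac_powser \<alpha> (\<lambda>k. a * c k + b * d k) t = a * frac_powser \<alpha> c t + b * frac_powser \<alpha> d t"
proof -
  note sums = summable_sums[OF summable_frac_powser[OF assms(1,3), of "t powr \<alpha>"]]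
    summable_sums[OF summable_frac_powser[OF assms(2,3), of "t powr \<alpha>"]]
  from sums_add[OF sums_mult[OF sums(1), of a] sums_mult[OF sums(2), of b]]
  have "(\<lambda>k. (a * c k + b * d k) / Gamma (1 + \<alpha> * real k) * (t powr \<alpha>) ^ k) sums
      (a * frac_powser \<alpha> c t + b * frac_powser \<alpha> d t)"
    by (simp add: frac_powser_def add_divide_distrib distrib_right mult.assoc)
  then show ?thesis by (simp add: frac_powser_def sums_iff)
qed

lemma mittag_leffler_sums:
  assumes "\<alpha> > 0"
  shows "(\<lambda>k. x ^ k / of_real (Gamma (1 + \<alpha> * real k))) sums mittag_leffler \<alpha> x"
  unfolding mittag_leffler_def
proof (rule summable_sums[OF summable_norm_cancel])
  have "Gamma (1 + \<alpha> * real k) > 0" for k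
    using assms by (intro Gamma_real_pos) (simp add: add_pos_nonneg)
  then have "norm (x ^ k / of_real (Gamma (1 + \<alpha> * real k)) :: complex) = norm x ^ k / Gamma (1 + \<alpha> * real k)" for k
    by (simp add: norm_divide norm_power abs_of_pos)
  then show "summable (\<lambda>k. norm (x ^ k / of_real (Gamma (1 + \<alpha> * real k)) :: complex))"
    using summable_power_div_Gamma[OF assms] by simp
qed

lemma frac_powser_eq_mittag_leffler:
  fixes lam a :: "'b \<Rightarrow> complex"
  assumes \<alpha>: "\<alpha> > 0" and c: "geom_bounded c"
    and eq: "\<And>k. complex_of_real (c k) = (\<Sum>j\<in>I. a j * lam j ^ k)"
  shows "complex_of_real (frac_powser \<alpha> c t) =
    (\<Sum>j\<in>I. mittag_leffler \<alpha> (lam j * of_real (t powr \<alpha>)) * a j)"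
proof (rule sums_unique2)
  show "(\<lambda>k. complex_of_real (c k / Gamma (1 + \<alpha> * real k) * (t powr \<alpha>) ^ k)) sums
      complex_of_real (frac_powser \<alpha> c t)"
    unfolding frac_powser_def by (intro sums_of_real summable_sums summable_frac_powser c \<alpha>)
  have "(\<lambda>k. \<Sum>j\<in>I. (lam j * of_real (t powr \<alpha>)) ^ k / of_real (Gamma (1 + \<alpha> * real k)) * a j) sums
      (\<Sum>j\<in>I. mittag_leffler \<alpha> (lam j * of_real (t powr \<alpha>)) * a j)"
    by (intro sums_sum sums_mult2 mittag_leffler_sums \<alpha>)
  moreover have "(\<Sum>j\<in>I. (lam j * of_real (t powr \<alpha>)) ^ k / of_real (Gamma (1 + \<alpha> * real k)) * a j) =
      complex_of_real (c k / Gamma (1 + \<alpha> * real k) * (t powr \<alpha>) ^ k)" for k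
    by (simp add: eq sum_divide_distrib sum_distrib_right sum_distrib_left power_mult_distrib mult_ac)
  ultimately show "(\<lambda>k. complex_of_real (c k / Gamma (1 + \<alpha> * real k) * (t powr \<alpha>) ^ k)) sums
      (\<Sum>j\<in>I. mittag_leffler \<alpha> (lam j * of_real (t powr \<alpha>)) * a j)"
    by (simp only:)
qed

lemma geom_bounded_Re_power_sum:
  fixes a r :: "'b \<Rightarrow> complex"
  assumes "finite I"
  shows "geom_bounded (\<lambda>k. Re (\<Sum>j\<in>I. a j * r j ^ k))"
proof -
  \<comment> \<open>The sum dominates each \<open>norm (r j)\<close> and, unlike a maximum, makes
    sense for empty \<open>I\<close>.\<close>
  define R where "R = (\<Sum>j\<in>I. norm (r j))"
  have "\<bar>Re (\<Sum>j\<in>I. a j * r j ^ k)\<bar> \<le> (\<Sum>j\<in>I. norm (a j)) * R ^ k" for k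
  proof -
    have "\<bar>Re (\<Sum>j\<in>I. a j * r j ^ k)\<bar> \<le> norm (\<Sum>j\<in>I. a j * r j ^ k)"
      by (rule abs_Re_le_cmod)
    also have "\<dots> \<le> (\<Sum>j\<in>I. norm (a j) * norm (r j) ^ k)"
      by (rule order.trans[OF norm_sum]) (simp add: norm_mult norm_power)
    also have "\<dots> \<le> (\<Sum>j\<in>I. norm (a j) * R ^ k)"
      unfolding R_def using assms
      by (intro sum_mono mult_left_mono power_mono member_le_sum) auto
    finally show ?thesis by (simp add: sum_distrib_right)
  qed
  then show ?thesis unfolding geom_bounded_def by blast
qed

lemma mixed_solution_exists:
  fixes A :: "nat \<Rightarrow> complex^2" and lam :: "nat \<Rightarrow> complex"
  assumes \<alpha>: "0 < \<alpha>" "\<alpha> \<le> 1" and K: "0 < K" "real K * \<alpha> \<le> 1"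
    and DA: "DA = a1 * b2 - a2 * b1"
    and P: "\<And>w. mixed_char_fun K a1 b2 DA w = (\<Prod>j=1..K+1. (w - lam j))"
    and A: "mixed_partial_fractions K a1 a2 b1 b2 DA y0 lam A"
  shows "\<exists>y. mixed_index_solution \<alpha> (real K * \<alpha>) a1 a2 b1 b2 y0 y \<and>
    (\<forall>t. complex_vec (y t) = (\<Sum>j=1..K+1. mittag_leffler \<alpha> (lam j * of_real (t powr \<alpha>)) *s A j))"
proof -
  define c1 where "c1 k = (\<Sum>j=1..K+1. A j $ 1 * lam j ^ k)" for k
  define c2 where "c2 k = (\<Sum>j=1..K+1. A j $ 2 * lam j ^ k)" for k
  note rec = mixed_recurrence[OF K(1) DA P A, folded c1_def c2_def]
  \<comment> \<open>The eigenvalues may be nonreal, but the recurrence has real data. Strong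
    induction is used because \<open>c1\<close> looks back one step and \<open>c2\<close> looks back
    \<open>K\<close> steps.\<close>
  have real: "c1 k \<in> \<real> \<and> c2 k \<in> \<real>" for k
  proof (induction k rule: less_induct)
    case (less k)
    have "c1 k \<in> \<real>"
    proof (cases k)
      case 0
      then show ?thesis by (simp add: rec(1))
    next
      case (Suc m)
      then show ?thesis using less[of m] by (auto simp: rec(3))
    qed
    moreover have "c2 k \<in> \<real>"
    proof (cases "k < K")
      case True
      then show ?thesis using rec(2) rec(4)[of k] by (cases "k = 0") auto
    next
      case False
      then show ?thesis using less[of "k - K"] rec(5)[of "k - K"] K by auto
    qed
    ultimately show ?case ..
  qed
  define r1 where "r1 k = Re (c1 k)" for k
  define r2 where "r2 k = Re (c2 k)" for k
  have c: "c1 k = of_real (r1 k)" "c2 k = of_real (r2 k)" for k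
    using real[of k] by (simp_all add: r1_def r2_def)
  have r: "r1 0 = y0 $ 1" "r2 0 = y0 $ 2" "\<And>k. r1 (Suc k) = a1 * r1 k + a2 * r2 k"
    "\<And>k. 0 < k \<Longrightarrow> k < K \<Longrightarrow> r2 k = 0" "\<And>k. r2 (k + K) = b1 * r1 k + b2 * r2 k"
    unfolding r1_def r2_def rec by (simp_all add: c)
  have gb: "geom_bounded r1" "geom_bounded r2"
    unfolding r1_def[abs_def] r2_def[abs_def] c1_def c2_def
    by (intro geom_bounded_Re_power_sum finite_atLeastAtMost)+
  define y :: "real \<Rightarrow> real^2" where "y t = vector [frac_powser \<alpha> r1 t, frac_powser \<alpha> r2 t]" for t
  have y: "y t $ 1 = frac_powser \<alpha> r1 t" "y t $ 2 = frac_powser \<alpha> r2 t" for t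
    by (simp_all add: y_def)
  \<comment> \<open>For the first component the shift is by one index, so the vanishing condition on
    coefficients is vacuous.\<close>
  have "caputo_differentiable \<alpha> (frac_powser \<alpha> r1)"
    using frac_powser_caputo(1)[where K = 1, OF gb(1) \<alpha>(1)] \<alpha>(2) by simp
  moreover have "caputo_deriv \<alpha> (frac_powser \<alpha> r1) t = a1 * frac_powser \<alpha> r1 t + a2 * frac_powser \<alpha> r2 t"
    if "t > 0" for t
    using frac_powser_caputo(2)[where K = 1, OF gb(1) \<alpha>(1) _ _ _ that] \<alpha>(2)
    by (simp add: r(3) frac_powser_lincomb gb \<alpha>)
  moreover have "caputo_differentiable (real K * \<alpha>) (frac_powser \<alpha> r2)"
    using frac_powser_caputo(1)[OF gb(2) \<alpha>(1) K(2,1) r(4)] by simp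
  moreover have "caputo_deriv (real K * \<alpha>) (frac_powser \<alpha> r2) t = b1 * frac_powser \<alpha> r1 t + b2 * frac_powser \<alpha> r2 t"
    if "t > 0" for t
    using frac_powser_caputo(2)[OF gb(2) \<alpha>(1) K(2,1) r(4) that]
    by (simp add: r(5) frac_powser_lincomb gb \<alpha>)
  moreover have "y 0 = y0"
    by (simp add: vec_eq_iff forall_2 y frac_powser_0 r)
  ultimately have "mixed_index_solution \<alpha> (real K * \<alpha>) a1 a2 b1 b2 y0 y"
    by (simp add: mixed_index_solution_def y)
  moreover have "complex_vec (y t) = (\<Sum>j=1..K+1. mittag_leffler \<alpha> (lam j * of_real (t powr \<alpha>)) *s A j)" for t
    using frac_powser_eq_mittag_leffler[OF \<alpha>(1) gb(1), of "\<lambda>j. A j $ 1" lam "{1..K+1}" t]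
      frac_powser_eq_mittag_leffler[OF \<alpha>(1) gb(2), of "\<lambda>j. A j $ 2" lam "{1..K+1}" t]
      c[unfolded c1_def c2_def]
    by (simp add: vec_eq_iff forall_2 complex_vec_def y del: sum.cl_ivl_Suc)
  ultimately show ?thesis by blast
qed

text \<open>Simple eigenvalues guarantee simple poles, hence vectors \<open>A\<close>. For any
  \<open>A\<close> satisfying the identity, the constructed series is a solution, and uniqueness
  transfers its formula to every solution.\<close>

theorem corollary16:
  fixes \<alpha> \<beta> a1 a2 b1 b2 DA :: real and K :: nat
    and y0 :: "real^2" and lam :: "nat \<Rightarrow> complex"
  assumes "\<alpha> \<in> \<rat>" and "0 < \<alpha>" and "\<alpha> \<le> 1"
    and "0 < K" and "\<beta> = real K * \<alpha>" and "\<beta> \<le> 1"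
    and "DA = a1 * b2 - a2 * b1"
    and "\<And>w. mixed_char_fun K a1 b2 DA w = (\<Prod>j=1..K+1. (w - lam j))"
  shows "(inj_on lam {1..K+1} \<longrightarrow> (\<exists>A. mixed_partial_fractions K a1 a2 b1 b2 DA y0 lam A)) \<and>
         (\<forall>A. mixed_partial_fractions K a1 a2 b1 b2 DA y0 lam A \<longrightarrow>
            (\<exists>y. mixed_index_solution \<alpha> \<beta> a1 a2 b1 b2 y0 y) \<and>
            (\<forall>y. mixed_index_solution \<alpha> \<beta> a1 a2 b1 b2 y0 y \<longrightarrow>
               (\<forall>t\<ge>0. complex_vec (y t) =
                  (\<Sum>j=1..K+1. mittag_leffler \<alpha> (lam j * of_real (t powr \<alpha>)) *s A j))))"
proof (intro conjI impI allI)
  assume "inj_on lam {1..K+1}"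
  then show "\<exists>A. mixed_partial_fractions K a1 a2 b1 b2 DA y0 lam A"
    using assms(8) by (rule mixed_partial_fractions_exist)
next
  fix A assume A: "mixed_partial_fractions K a1 a2 b1 b2 DA y0 lam A"
  have K\<alpha>: "real K * \<alpha> \<le> 1" using assms(5,6) by simp
  obtain x where x: "mixed_index_solution \<alpha> \<beta> a1 a2 b1 b2 y0 x"
    and x_eq: "\<And>t. complex_vec (x t) = (\<Sum>j=1..K+1. mittag_leffler \<alpha> (lam j * of_real (t powr \<alpha>)) *s A j)"
    using mixed_solution_exists[OF assms(2,3,4) K\<alpha> assms(7,8) A, folded assms(5)] by blast
  show "\<exists>y. mixed_index_solution \<alpha> \<beta> a1 a2 b1 b2 y0 y"
    using x by blast
  fix y and t :: real
  assume "mixed_index_solution \<alpha> \<beta> a1 a2 b1 b2 y0 y" "0 \<le> t"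
  then have "y t = x t"
    by (rule mixed_index_solution_unique[OF assms(2,3,4) K\<alpha>, folded assms(5), OF _ x])
  then show "complex_vec (y t) = (\<Sum>j=1..K+1. mittag_leffler \<alpha> (lam j * of_real (t powr \<alpha>)) *s A j)"
    by (simp only: x_eq)
qed

end
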